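(* Let $X$ be a Banach space, let $c>0$ and $q>1$, and let $(A_n)_{n\in\mathbb{N}}$ be a sequence of invertible bounded linear operators on $X$ such that the equation $x_{m+1}=A_mx_m$, $m\in\mathbb{N}$, admits a nonuniform $(\mu,\nu)$-dichotomy for some growth rates $\mu=(\mu_n)_{n\in\mathbb{N}_0}$ and $\nu=(\nu_n)_{n\in\mathbb{N}_0}$, with constants $D\ge1$, $a<0\le b$ and $\varepsilon>0$. Assume that $$\lim_{m\to+\infty}\mu_m^a\,\mu_{m-1}^{-b}\,\nu_{m-1}^{\varepsilon}=0,$$ that the series $\sum_{k=1}^{+\infty}\mu_k^{aq}\nu_k^{\varepsilon}$ is convergent, and that, with $$\beta_m=\frac{\mu_{m-1}^a}{\nu_{m-1}^{\varepsilon(1+1/q)}\left(\sum_{k=m}^{+\infty}\mu_k^{aq}\nu_k^{\varepsilon}\right)^{1/q}},\qquad \tilde\beta_m=\beta_m\,\nu_{m-1}^{-\varepsilon},\qquad m\in\mathbb{N},$$ there is a constant $K\ge1$ such that $$\frac{\mu_m^a\beta_m^{-1}}{\mu_{n-1}^a\beta_n^{-1}}\le K\quad\text{for every } n\in\mathbb{N}\text{ and every } m\ge n.$$ Let $C>D$. Then, choosing $\delta>0$ sufficiently small, $$\|\phi-\bar\phi\|'\le\|f-\bar f\|'''$$ for every $f,\bar f\in\mathcal{P}_{c,q}$, where $\phi\in\mathcal{X}_{\delta,\beta}$ is the unique element of $\mathcal{X}_{\delta,\beta}$ such that $$\mathcal{F}^{f}_{m,n}\bigl(\mathcal{V}_{\phi,n,\delta/(CK),\tilde\beta}\bigr)\subseteq\mathcal{V}_{\phi,m,\delta,\beta}\quad\text{for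 every } n\in\mathbb{N}\text{ and every } m\ge n,$$ and $\bar\phi\in\mathcal{X}_{\delta,\beta}$ is the unique element of $\mathcal{X}_{\delta,\beta}$ satisfying the same condition with $f$ replaced by $\bar f$ and $\phi$ replaced by $\bar\phi$.
   Context: $\mathbb{N}=\{1,2,\dots\}$, $\mathbb{N}_0=\mathbb{N}\cup\{0\}$. A growth rate is an increasing sequence $\mu=(\mu_n)_{n\in\mathbb{N}_0}$ of real numbers with $\mu_0\ge 1$ and $\lim_{n\to+\infty}\mu_n=+\infty$. Given a sequence $(A_n)_{n\in\mathbb{N}}$ of invertible bounded linear operators on $X$, put $\mathcal{A}_{m,n}=A_{m-1}\cdots A_n$ if $m>n$ and $\mathcal{A}_{n,n}=\mathrm{Id}$. The equation $x_{m+1}=A_mx_m$, $m\in\mathbb{N}$, admits a nonuniform $(\mu,\nu)$-dichotomy (for growth rates $\mu,\nu$) if there exist projections $P_m$, $m\in\mathbb{N}$, with $P_m\mathcal{A}_{m,n}=\mathcal{A}_{m,n}P_n$ for $m\ge n$ in $\mathbb{N}$, and constants $a<0\le b$, $\varepsilon\ge0$, $D\ge1$ such that for every $n\in\mathbb{N}$ and every $m\ge n$ $$\|\mathcal{A}_{m,n}P_n\|\le D\left(\frac{\mu_m}{\mu_{n-1}}\right)^a\nu_{n-1}^{\varepsilon},\qquad \|\mathcal{A}_{m,n}^{-1}Q_m\|\le D\left(\frac{\mu_{m-1}}{\mu_n}\right)^{-b}\nu_{m-1}^{\varepsilon},$$ where $Q_m=\mathrm{Id}-P_m$. The projections are fixed,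 and $E_n=P_n(X)$, $F_n=Q_n(X)$. The spaces $E_n\times F_n$ and $E_n\oplus F_n=X$ are identified, so $(\xi,\eta)\in E_n\times F_n$ is the vector $\xi+\eta\in X$. $\mathcal{P}_{c,q}$ is the class of all sequences $f=(f_n)_{n\in\mathbb{N}}$ of functions $f_n\colon X\to X$ such that $f_n(0)=0$ and $\|f_n(u)-f_n(v)\|\le c\|u-v\|(\|u\|+\|v\|)^q$ for every $n\in\mathbb{N}$ and $u,v\in X$. It carries the metric $$\|f-\bar f\|'''=\sup\left\{\frac{\|f_n(u)-\bar f_n(u)\|}{\|u\|^{q+1}}: n\in\mathbb{N},\ u\in X\setminus\{0\}\right\}.$$ For $f\in\mathcal{P}_{c,q}$ and $m>n$, $\mathcal{F}^f_{m,n}=(A_{m-1}+f_{m-1})\circ\cdots\circ(A_n+f_n)$, and $\mathcal{F}^f_{n,n}=\mathrm{Id}$. $B_n(r)$ is the open ball of $E_n$ centered at $0$ with radius $r>0$. For $\delta>0$ and a positive sequence $\beta=(\beta_n)_{n\in\mathbb{N}}$, $\mathcal{X}_{\delta,\beta}$ is the space of sequences $\phi=(\phi_n)_{n\in\mathbb{N}}$ of continuous functions $\phi_n\colon B_n(\delta\beta_n)\to F_n$ such that $\phi_n(0)=0$ and $\|\phi_n(\xi)-\phi_n(\bar\xi)\|\le\|\xi-\bar\xi\|$ for every $n\in\mathbb{N}$ and every $\xi,\bar\xi\in B_n(\delta\beta_n)$. It carries the metric $$\|\phi-\psi\|'=\sup\left\{\frac{\|\phi_n(\xi)-\psi_n(\xi)\|}{\|\xi\|}: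 n\in\mathbb{N},\ \xi\in B_n(\delta\beta_n)\setminus\{0\}\right\}.$$ For a sequence $\phi=(\phi_n)_{n\in\mathbb{N}}\in\mathcal{X}_{\delta,\beta}$ (with $\delta>0$ and $\beta=(\beta_n)_{n\in\mathbb{N}}$ a positive sequence), $\delta'>0$ and a positive sequence $\beta'=(\beta'_n)_{n\in\mathbb{N}}$ such that $\phi_n$ is defined on $B_n(\delta'\beta'_n)$, put $\mathcal{V}_{\phi,n,\delta',\beta'}=\{(\xi,\phi_n(\xi)):\xi\in B_n(\delta'\beta'_n)\}$. The paper's local stable manifold theorem asserts that, under the hypotheses of the claim on the dichotomy, for each $f\in\mathcal{P}_{c,q}$ and $C>D$ and for $\delta>0$ sufficiently small, there is a unique $\phi\in\mathcal{X}_{\delta,\beta}$ with the invariance property in the claim; $\phi$ and $\bar\phi$ are the functions given by that theorem for $f$ and $\bar f$ with the same constant $C$.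
   Formalization: Uniqueness of φ in X_{δ,β} fails in general; it is proved only on the balls of radius δβ̃_n/(CK). The inequality on the full balls is proved for a suitable choice of invariant φ for each f, and for any φ, φ̄ that are unique in X_{δ,β}. *)

theory Defs
  imports "HOL-Analysis.Analysis"
begin

text \<open>
  Sequences indexed by the positive integers are functions on \<open>nat\<close> whose value at \<open>0\<close> is irrelevant;
  all conditions on them are imposed for indices \<open>n \<ge> 1\<close> only. Growth rates are indexed from \<open>0\<close>.
  ``Increasing'' is read in the weak sense, which includes the strict one.
\<close>

definition growth_rate :: "(nat \<Rightarrow> real) \<Rightarrow> bool" where
  "growth_rate \<mu> \<longleftrightarrow> incseq \<mu> \<and> 1 \<le> \<mu> 0 \<and> filterlim \<mu> at_top sequentially"

definition blinfun_invertible :: "('a::real_normed_vector \<Rightarrow>\<^sub>L 'a) \<Rightarrow> bool" where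
  "blinfun_invertible T \<longleftrightarrow> (\<exists>S. S o\<^sub>L T = id_blinfun \<and> T o\<^sub>L S = id_blinfun)"

definition blinfun_inv :: "('a::real_normed_vector \<Rightarrow>\<^sub>L 'a) \<Rightarrow> ('a \<Rightarrow>\<^sub>L 'a)" where
  "blinfun_inv T = (THE S. S o\<^sub>L T = id_blinfun \<and> T o\<^sub>L S = id_blinfun)"

text \<open>\<open>evol A m n = A (m - 1) \<circ> \<dots> \<circ> A n\<close>; only meaningful for \<open>m \<ge> n\<close>, and likewise \<open>nl_evol\<close>.\<close>

fun evol :: "(nat \<Rightarrow> ('a::real_normed_vector \<Rightarrow>\<^sub>L 'a)) \<Rightarrow> nat \<Rightarrow> nat \<Rightarrow> ('a \<Rightarrow>\<^sub>L 'a)" where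
  "evol A 0 n = id_blinfun"
| "evol A (Suc m) n = (if n \<le> m then A m o\<^sub>L evol A m n else id_blinfun)"

fun nl_evol ::
  "(nat \<Rightarrow> ('a::real_normed_vector \<Rightarrow>\<^sub>L 'a)) \<Rightarrow> (nat \<Rightarrow> 'a \<Rightarrow> 'a) \<Rightarrow> nat \<Rightarrow> nat \<Rightarrow> 'a \<Rightarrow> 'a" where
  "nl_evol A f 0 n = id"
| "nl_evol A f (Suc m) n = (if n \<le> m then (\<lambda>x. A m x + f m x) \<circ> nl_evol A f m n else id)"

definition compl_proj :: "(nat \<Rightarrow> ('a::real_normed_vector \<Rightarrow>\<^sub>L 'a)) \<Rightarrow> nat \<Rightarrow> ('a \<Rightarrow>\<^sub>L 'a)" where
  "compl_proj P n = id_blinfun - P n"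

definition dichotomy ::
  "(nat \<Rightarrow> ('a::real_normed_vector \<Rightarrow>\<^sub>L 'a)) \<Rightarrow> (nat \<Rightarrow> real) \<Rightarrow> (nat \<Rightarrow> real) \<Rightarrow>
   (nat \<Rightarrow> ('a \<Rightarrow>\<^sub>L 'a)) \<Rightarrow> real \<Rightarrow> real \<Rightarrow> real \<Rightarrow> real \<Rightarrow> bool" where
  "dichotomy A \<mu> \<nu> P D a b \<epsilon> \<longleftrightarrow>
     a < 0 \<and> 0 \<le> b \<and> 0 \<le> \<epsilon> \<and> 1 \<le> D \<and>
     (\<forall>n\<ge>1. P n o\<^sub>L P n = P n) \<and>
     (\<forall>n\<ge>1. \<forall>m\<ge>n. P m o\<^sub>L evol A m n = evol A m n o\<^sub>L P n) \<and>
     (\<forall>n\<ge>1. \<forall>m\<ge>n.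
        norm (evol A m n o\<^sub>L P n) \<le> D * (\<mu> m / \<mu> (n - 1)) powr a * \<nu> (n - 1) powr \<epsilon> \<and>
        norm (blinfun_inv (evol A m n) o\<^sub>L compl_proj P m)
          \<le> D * (\<mu> (m - 1) / \<mu> n) powr (- b) * \<nu> (m - 1) powr \<epsilon>)"

definition stable_space :: "(nat \<Rightarrow> ('a::real_normed_vector \<Rightarrow>\<^sub>L 'a)) \<Rightarrow> nat \<Rightarrow> 'a set" where
  "stable_space P n = range (blinfun_apply (P n))"

definition unstable_space :: "(nat \<Rightarrow> ('a::real_normed_vector \<Rightarrow>\<^sub>L 'a)) \<Rightarrow> nat \<Rightarrow> 'a set" where
  "unstable_space P n = range (blinfun_apply (compl_proj P n))"

definition stable_ball :: "(nat \<Rightarrow> ('a::real_normed_vector \<Rightarrow>\<^sub>L 'a)) \<Rightarrow> nat \<Rightarrow> real \<Rightarrow> 'a set" where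
  "stable_ball P n r = {\<xi> \<in> stable_space P n. norm \<xi> < r}"

definition perturbations :: "real \<Rightarrow> real \<Rightarrow> (nat \<Rightarrow> 'a::real_normed_vector \<Rightarrow> 'a) set" where
  "perturbations c q = {f. \<forall>n\<ge>1. f n 0 = 0 \<and>
     (\<forall>u v. norm (f n u - f n v) \<le> c * norm (u - v) * (norm u + norm v) powr q)}"

text \<open>
  The two metrics are suprema in \<open>ennreal\<close>, so that a supremum over the empty set
  (trivial space or trivial stable spaces) is \<open>0\<close>.
\<close>

definition perturbation_dist ::
  "real \<Rightarrow> (nat \<Rightarrow> 'a::real_normed_vector \<Rightarrow> 'a) \<Rightarrow> (nat \<Rightarrow> 'a \<Rightarrow> 'a) \<Rightarrow> ennreal" where
  "perturbation_dist q f g =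
     Sup {ennreal (norm (f n u - g n u) / norm u powr (q + 1)) | n u. 1 \<le> n \<and> u \<noteq> 0}"

text \<open>Only the values of \<open>\<phi> n\<close> on the ball of radius \<open>\<delta> * \<beta> n\<close> matter below.\<close>

definition graph_space ::
  "(nat \<Rightarrow> ('a::real_normed_vector \<Rightarrow>\<^sub>L 'a)) \<Rightarrow> real \<Rightarrow> (nat \<Rightarrow> real) \<Rightarrow> (nat \<Rightarrow> 'a \<Rightarrow> 'a) set" where
  "graph_space P \<delta> \<beta> = {\<phi>. \<forall>n\<ge>1.
     continuous_on (stable_ball P n (\<delta> * \<beta> n)) (\<phi> n) \<and>
     \<phi> n ` stable_ball P n (\<delta> * \<beta> n) \<subseteq> unstable_space P n \<and>
     \<phi> n 0 = 0 \<and>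
     (\<forall>\<xi>\<in>stable_ball P n (\<delta> * \<beta> n). \<forall>\<xi>'\<in>stable_ball P n (\<delta> * \<beta> n).
        norm (\<phi> n \<xi> - \<phi> n \<xi>') \<le> norm (\<xi> - \<xi>'))}"

definition graph_dist ::
  "(nat \<Rightarrow> ('a::real_normed_vector \<Rightarrow>\<^sub>L 'a)) \<Rightarrow> real \<Rightarrow> (nat \<Rightarrow> real) \<Rightarrow>
   (nat \<Rightarrow> 'a \<Rightarrow> 'a) \<Rightarrow> (nat \<Rightarrow> 'a \<Rightarrow> 'a) \<Rightarrow> ennreal" where
  "graph_dist P \<delta> \<beta> \<phi> \<psi> =
     Sup {ennreal (norm (\<phi> n \<xi> - \<psi> n \<xi>) / norm \<xi>) | n \<xi>.
            1 \<le> n \<and> \<xi> \<in> stable_ball P n (\<delta> * \<beta> n) - {0}}"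

definition same_on_balls ::
  "(nat \<Rightarrow> ('a::real_normed_vector \<Rightarrow>\<^sub>L 'a)) \<Rightarrow> (nat \<Rightarrow> real) \<Rightarrow>
   (nat \<Rightarrow> 'a \<Rightarrow> 'a) \<Rightarrow> (nat \<Rightarrow> 'a \<Rightarrow> 'a) \<Rightarrow> bool" where
  "same_on_balls P r \<phi> \<psi> \<longleftrightarrow> (\<forall>n\<ge>1. \<forall>\<xi>\<in>stable_ball P n (r n). \<phi> n \<xi> = \<psi> n \<xi>)"

definition local_graph ::
  "(nat \<Rightarrow> ('a::real_normed_vector \<Rightarrow>\<^sub>L 'a)) \<Rightarrow> (nat \<Rightarrow> 'a \<Rightarrow> 'a) \<Rightarrow> nat \<Rightarrow> real \<Rightarrow> (nat \<Rightarrow> real) \<Rightarrow> 'a set" where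
  "local_graph P \<phi> n \<delta> \<beta> = {\<xi> + \<phi> n \<xi> | \<xi>. \<xi> \<in> stable_ball P n (\<delta> * \<beta> n)}"

definition beta_seq ::
  "(nat \<Rightarrow> real) \<Rightarrow> (nat \<Rightarrow> real) \<Rightarrow> real \<Rightarrow> real \<Rightarrow> real \<Rightarrow> nat \<Rightarrow> real" where
  "beta_seq \<mu> \<nu> a \<epsilon> q m =
     \<mu> (m - 1) powr a /
     (\<nu> (m - 1) powr (\<epsilon> * (1 + 1 / q)) *
      (\<Sum>k. \<mu> (k + m) powr (a * q) * \<nu> (k + m) powr \<epsilon>) powr (1 / q))"

definition beta_tilde ::
  "(nat \<Rightarrow> real) \<Rightarrow> (nat \<Rightarrow> real) \<Rightarrow> real \<Rightarrow> real \<Rightarrow> real \<Rightarrow> nat \<Rightarrow> real" where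
  "beta_tilde \<mu> \<nu> a \<epsilon> q m = beta_seq \<mu> \<nu> a \<epsilon> q m * \<nu> (m - 1) powr (- \<epsilon>)"

definition invariant_graph ::
  "(nat \<Rightarrow> ('a::real_normed_vector \<Rightarrow>\<^sub>L 'a)) \<Rightarrow> (nat \<Rightarrow> ('a \<Rightarrow>\<^sub>L 'a)) \<Rightarrow>
   real \<Rightarrow> (nat \<Rightarrow> real) \<Rightarrow> real \<Rightarrow> (nat \<Rightarrow> real) \<Rightarrow>
   (nat \<Rightarrow> 'a \<Rightarrow> 'a) \<Rightarrow> (nat \<Rightarrow> 'a \<Rightarrow> 'a) \<Rightarrow> bool" where
  "invariant_graph A P \<delta> \<beta> \<delta>' \<beta>' f \<phi> \<longleftrightarrow>
     \<phi> \<in> graph_space P \<delta> \<beta> \<and>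
     (\<forall>n\<ge>1. \<forall>m\<ge>n. nl_evol A f m n ` local_graph P \<phi> n \<delta>' \<beta>' \<subseteq> local_graph P \<phi> m \<delta> \<beta>)"

text \<open>
  Uniqueness as an element of \<open>graph_space P \<delta> \<beta>\<close>, that is, on the balls of radius \<open>\<delta> * \<beta> n\<close>.
  Pitfall: this is more than invariance can give in general. The invariance condition starts only
  from the balls of radius \<open>\<delta>' * \<beta>' n\<close>; if these are smaller, then for \<open>n = 1\<close> it says nothing about
  \<open>\<phi> 1\<close> in between. What invariance does determine is \<open>\<phi>\<close> on the balls of radius \<open>\<delta>' * \<beta>' n\<close>.
\<close>

definition unique_invariant_graph ::
  "(nat \<Rightarrow> ('a::real_normed_vector \<Rightarrow>\<^sub>L 'a)) \<Rightarrow> (nat \<Rightarrow> ('a \<Rightarrow>\<^sub>L 'a)) \<Rightarrow>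
   real \<Rightarrow> (nat \<Rightarrow> real) \<Rightarrow> real \<Rightarrow> (nat \<Rightarrow> real) \<Rightarrow>
   (nat \<Rightarrow> 'a \<Rightarrow> 'a) \<Rightarrow> (nat \<Rightarrow> 'a \<Rightarrow> 'a) \<Rightarrow> bool" where
  "unique_invariant_graph A P \<delta> \<beta> \<delta>' \<beta>' f \<phi> \<longleftrightarrow>
     invariant_graph A P \<delta> \<beta> \<delta>' \<beta>' f \<phi> \<and>
     (\<forall>\<psi>. invariant_graph A P \<delta> \<beta> \<delta>' \<beta>' f \<psi> \<longrightarrow> same_on_balls P (\<lambda>n. \<delta> * \<beta> n) \<psi> \<phi>)"

end

theory Submission
  imports Defs
begin

text \<open>
  The proof is the Lyapunov-Perron method, applied to each initial value separately. Fix a starting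
  time \<open>n\<close> and call an orbit \<open>z\<close> of the perturbed equation decaying if \<open>norm (z k) \<le> M * \<mu> k powr a\<close>
  for all \<open>k \<ge> n\<close>. Because of the limit hypothesis, the unstable component of a decaying orbit is
  determined by its future, so that decaying orbits are the solutions of a fixed point equation whose
  only parameter is the stable component \<open>\<xi>\<close> of the initial value
  (\<open>decaying_orbit_green_equation\<close>, \<open>green_equation_decaying_orbit\<close>). The perturbation has order
  \<open>q + 1\<close> at the origin; hence in the norm with weight \<open>\<mu> k powr a\<close> the equation is contractive with
  a constant proportional to \<open>M powr q * (\<Sum>k\<ge>n. \<mu> k powr (a * q) * \<nu> k powr \<epsilon>)\<close>. For \<open>M\<close> of the
  size forced by an initial value in the ball of radius \<open>\<delta> * \<beta> n\<close>, this constant is at most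
  a multiple of \<open>\<delta> powr q * \<nu> (n - 1) powr (- \<epsilon>)\<close>, by the definition of \<open>\<beta>\<close> (\<open>gain_radius_tail\<close>).

  So for small \<open>\<delta>\<close> each stable vector \<open>\<xi>\<close> of norm less than \<open>\<delta> * \<beta> n\<close> is the stable component of
  exactly one orbit decaying with such a constant \<open>M\<close>, and its unstable component at time \<open>n\<close>
  defines the value at \<open>\<xi>\<close> of a graph, \<open>stable_graph f n \<xi>\<close>. The remaining factor \<open>\<nu> (n - 1) powr (- \<epsilon>)\<close> absorbs the nonuniform
  factor of the dichotomy, which gives the Lipschitz constant \<open>1\<close> (\<open>stable_graph_lipschitz\<close>) and, when
  \<open>f\<close> is replaced by \<open>g\<close> in the fixed point equation, the asserted dependence on the perturbation
  (\<open>stable_graph_perturbation\<close>), both on the full balls of radius \<open>\<delta> * \<beta> n\<close>.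

  If the initial value lies in the smaller ball of radius \<open>\<delta> / (C * K) * \<beta>' n\<close>, the hypothesis on \<open>K\<close>
  keeps the stable component of the orbit inside the balls of radius \<open>\<delta> * \<beta> m\<close>; as tails of decaying
  orbits decay, the graph is invariant (\<open>stable_graph_invariant\<close>). Conversely, orbits that stay
  on an invariant graph decay, so that the graph coincides with the stable graph on the smaller balls
  (\<open>invariant_graph_eq_stable_graph\<close>). Graphs that are unique on the larger balls agree there with the
  stable graph, and inherit its dependence on the perturbation.
\<close>

section \<open>Perturbations of order greater than one\<close>

lemma perturbations_diff:
  assumes "f \<in> perturbations c q" and "1 \<le> k"
  shows "norm (f k u - f k v) \<le> c * norm (u - v) * (norm u + norm v) powr q"
  using assms unfolding perturbations_def by blast

lemma perturbations_zero:
  assumes "f \<in> perturbations c q" and "1 \<le> k"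
  shows "f k 0 = 0"
  using assms unfolding perturbations_def by blast

text \<open>
  A perturbation has order \<open>q + 1\<close> at the origin: on vectors of size at most a multiple of \<open>s\<close> both
  its size and its differences are of size \<open>s powr (q + 1)\<close>. The scale \<open>s\<close> is the decay rate of an
  orbit below, and the extra factor \<open>s powr q\<close> is what makes the sums along orbits converge.
  The term with \<open>d\<close> accounts for replacing one perturbation by another.
\<close>
lemma perturbations_diff_weighted:
  assumes f: "f \<in> perturbations c q" and k: "1 \<le> k"
    and c: "0 \<le> c" and q: "0 \<le> q" and M: "0 \<le> M" and s: "0 < s"
    and x: "norm x \<le> M * s" and y: "norm y \<le> M * s" and xy: "norm (x - y) \<le> N * s"
    and d: "norm (f k y - g k y) \<le> d * norm y powr (q + 1)" "0 \<le> d"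
  shows "norm (f k x - g k y) \<le> (c * N * (2 * M) powr q + d * M powr (q + 1)) * s powr (q + 1)"
proof -
  have "norm (f k x - g k y) \<le> norm (f k x - f k y) + norm (f k y - g k y)"
    by (metis diff_add_cancel add_diff_eq norm_triangle_ineq)
  also have "norm (f k x - f k y) \<le> c * norm (x - y) * (norm x + norm y) powr q"
    by (rule perturbations_diff[OF f k])
  also have "\<dots> \<le> c * (N * s) * (2 * M * s) powr q"
    using c q x y xy order_trans[OF norm_ge_zero xy] by (intro mult_mono powr_mono2) auto
  also have "\<dots> = c * N * (2 * M) powr q * s powr (q + 1)"
    using M s by (simp add: powr_mult powr_add)
  also have "norm (f k y - g k y) \<le> d * (M * s) powr (q + 1)"
    by (rule order_trans[OF d(1)], rule mult_left_mono[OF powr_mono2]) (use y d q in auto)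
  also have "\<dots> = d * M powr (q + 1) * s powr (q + 1)"
    using M s by (simp add: powr_mult)
  finally show ?thesis by (simp add: algebra_simps)
qed

lemma perturbations_norm_weighted:
  assumes f: "f \<in> perturbations c q" and k: "1 \<le> k"
    and c: "0 \<le> c" and q: "0 \<le> q" and M: "0 \<le> M" and s: "0 < s" and x: "norm x \<le> M * s"
  shows "norm (f k x) \<le> c * M powr (q + 1) * s powr (q + 1)"
proof -
  have "norm (f k x - f k 0) \<le> c * norm (x - 0) * (norm x + norm (0::'a)) powr q"
    by (rule perturbations_diff[OF f k])
  then have "norm (f k x) \<le> c * norm x powr (q + 1)"
    using perturbations_zero[OF f k] by (cases "x = 0") (auto simp: powr_add mult_ac)
  also have "\<dots> \<le> c * (M * s) powr (q + 1)"
    using c q x by (intro mult_mono powr_mono2) auto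
  also have "\<dots> = c * M powr (q + 1) * s powr (q + 1)"
    using M s by (simp add: powr_mult)
  finally show ?thesis .
qed

section \<open>Weighted kernels on sequences\<close>

text \<open>
  A kernel acting on sequences, measured in the norm \<open>sup\<^sub>k norm (x k) / t k\<close>. The bound on \<open>G\<close>
  ensures that a sequence of size \<open>t k powr (q + 1)\<close> is mapped to one of size \<open>t m\<close>, with operator
  norm at most \<open>D * suminf \<sigma>\<close>. Composed with a perturbation from \<open>perturbations c q\<close>, such a kernel
  is a contraction on every ball of sufficiently small radius. Index \<open>0\<close> is excluded because
  perturbations are constrained only from index \<open>1\<close> on.
\<close>
locale green_kernel =
  fixes G :: "nat \<Rightarrow> nat \<Rightarrow> ('a::banach \<Rightarrow>\<^sub>L 'a)"
    and t \<sigma> :: "nat \<Rightarrow> real"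
    and c q D :: real
  assumes t_pos: "0 < t k"
    and c_nonneg: "0 \<le> c" and q_pos: "0 < q" and D_nonneg: "0 \<le> D"
    and sigma_nonneg: "0 \<le> \<sigma> k" and sigma_summable: "summable \<sigma>"
    and G_bound: "norm (G m k) * t k powr (q + 1) \<le> D * t m * \<sigma> k"
    and G_zero: "G m 0 = 0"
begin

abbreviation total :: real where
  "total \<equiv> suminf \<sigma>"

lemma total_nonneg: "0 \<le> total"
  by (rule suminf_nonneg[OF sigma_summable sigma_nonneg])

lemma green_term_bound:
  assumes "norm v \<le> B * t k powr (q + 1)"
  shows "norm (G m k v) \<le> B * (D * t m) * \<sigma> k"
proof -
  have "0 \<le> B * t k powr (q + 1)" using assms norm_ge_zero order_trans by blast
  then have B: "0 \<le> B" using t_pos[of k] by (simp add: zero_le_mult_iff)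
  have "norm (G m k v) \<le> norm (G m k) * norm v" by (rule norm_blinfun)
  also have "\<dots> \<le> norm (G m k) * (B * t k powr (q + 1))" by (intro mult_left_mono assms) simp
  also have "\<dots> = B * (norm (G m k) * t k powr (q + 1))" by simp
  also have "\<dots> \<le> B * (D * t m * \<sigma> k)" by (intro mult_left_mono G_bound B)
  finally show ?thesis by simp
qed

lemma
  assumes "\<And>k. 1 \<le> k \<Longrightarrow> norm (v k) \<le> B * t k powr (q + 1)"
  shows green_summable: "summable (\<lambda>k. G m k (v k))"
    and green_sum_bound: "norm (\<Sum>k. G m k (v k)) \<le> D * total * B * t m"
proof -
  have "0 \<le> B * t 1 powr (q + 1)" using assms[of 1] norm_ge_zero order_trans by blast
  then have B: "0 \<le> B" using t_pos[of 1] by (simp add: zero_le_mult_iff)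
  have *: "norm (G m k (v k)) \<le> B * (D * t m) * \<sigma> k" for k
    using green_term_bound[OF assms, of k m] sigma_nonneg[of k] t_pos[of m] B D_nonneg
    by (cases "k = 0") (auto simp: G_zero)
  have s: "summable (\<lambda>k. B * (D * t m) * \<sigma> k)" by (intro summable_mult sigma_summable)
  show "summable (\<lambda>k. G m k (v k))"
    by (rule summable_comparison_test'[OF s *])
  have sn: "summable (\<lambda>k. norm (G m k (v k)))"
    by (rule summable_comparison_test'[OF s]) (use * in simp)
  have "norm (\<Sum>k. G m k (v k)) \<le> (\<Sum>k. norm (G m k (v k)))" by (rule summable_norm[OF sn])
  also have "\<dots> \<le> (\<Sum>k. B * (D * t m) * \<sigma> k)" by (rule suminf_le[OF * sn s])
  also have "\<dots> = D * total * B * t m"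
    by (subst suminf_mult[OF sigma_summable]) simp
  finally show "norm (\<Sum>k. G m k (v k)) \<le> D * total * B * t m" .
qed

lemma green_diff_bound:
  assumes f: "f \<in> perturbations c q" and g: "g \<in> perturbations c q" and M: "0 \<le> M"
    and x: "\<And>k. norm (x k) \<le> M * t k" and y: "\<And>k. norm (y k) \<le> M * t k"
    and xy: "\<And>k. norm (x k - y k) \<le> N * t k"
    and d: "0 \<le> d" "\<And>k u. 1 \<le> k \<Longrightarrow> norm (f k u - g k u) \<le> d * norm u powr (q + 1)"
  shows "norm ((\<Sum>k. G m k (f k (x k))) - (\<Sum>k. G m k (g k (y k))))
    \<le> D * total * (c * N * (2 * M) powr q + d * M powr (q + 1)) * t m"
proof -
  have sf: "summable (\<lambda>k. G m k (f k (x k)))" and sg: "summable (\<lambda>k. G m k (g k (y k)))"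
    by (rule green_summable, rule perturbations_norm_weighted[OF f _ c_nonneg _ M t_pos x], use q_pos in auto)
       (rule green_summable, rule perturbations_norm_weighted[OF g _ c_nonneg _ M t_pos y], use q_pos in auto)
  have "(\<Sum>k. G m k (f k (x k))) - (\<Sum>k. G m k (g k (y k))) = (\<Sum>k. G m k (f k (x k) - g k (y k)))"
    by (subst suminf_diff[OF sf sg]) (simp add: blinfun.diff_right)
  also have "norm \<dots> \<le> D * total * (c * N * (2 * M) powr q + d * M powr (q + 1)) * t m"
    using q_pos
    by (intro green_sum_bound perturbations_diff_weighted[OF f _ c_nonneg _ M t_pos x y xy _ d(1)] d(2)) auto
  finally show ?thesis .
qed

text \<open>
  With a Lipschitz constant at most \<open>1 / 2\<close>, the weighted distance of two solutions is at most
  twice the defect, which comes from the two inhomogeneities and from the distance \<open>d\<close> of the two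
  perturbations. Uniqueness of solutions (no defect), Lipschitz dependence on the initial value
  (\<open>d = 0\<close>) and dependence on the perturbation (equal inhomogeneities) are all instances.
\<close>
lemma green_solutions_close:
  assumes f: "f \<in> perturbations c q" and g: "g \<in> perturbations c q" and M: "0 \<le> M"
    and small: "D * c * (2 * M) powr q * total \<le> 1 / 2"
    and x: "\<And>k. norm (x k) \<le> M * t k" and y: "\<And>k. norm (y k) \<le> M * t k"
    and xeq: "\<And>m. x m = u m + (\<Sum>k. G m k (f k (x k)))"
    and yeq: "\<And>m. y m = v m + (\<Sum>k. G m k (g k (y k)))"
    and uv: "\<And>m. norm (u m - v m) \<le> L * t m"
    and d: "0 \<le> d" "\<And>k u. 1 \<le> k \<Longrightarrow> norm (f k u - g k u) \<le> d * norm u powr (q + 1)"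
  shows "norm (x m - y m) \<le> 2 * (L + D * total * d * M powr (q + 1)) * t m"
proof -
  define r where "r k = norm (x k - y k) / t k" for k
  define N where "N = (SUP k. r k)"
  have "r k \<le> 2 * M" for k
  proof -
    have "norm (x k - y k) \<le> norm (x k) + norm (y k)" by (rule norm_triangle_ineq4)
    also have "\<dots> \<le> 2 * M * t k" using x[of k] y[of k] by simp
    finally show ?thesis unfolding r_def using t_pos[of k] by (simp add: divide_le_eq)
  qed
  then have "bdd_above (range r)" by (intro bdd_aboveI2)
  then have "r k \<le> N" for k unfolding N_def by (rule cSUP_upper[OF UNIV_I])
  then have xy: "norm (x k - y k) \<le> N * t k" for k
    unfolding r_def using t_pos[of k] by (simp add: divide_le_eq)
  define R where "R = D * total * (c * N * (2 * M) powr q + d * M powr (q + 1))"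
  have "norm (x k - y k) \<le> (L + R) * t k" for k
  proof -
    have "x k - y k = (u k - v k) + ((\<Sum>j. G k j (f j (x j))) - (\<Sum>j. G k j (g j (y j))))"
      using xeq[of k] yeq[of k] by (simp add: algebra_simps)
    then have "norm (x k - y k) \<le> norm (u k - v k)
        + norm ((\<Sum>j. G k j (f j (x j))) - (\<Sum>j. G k j (g j (y j))))"
      by (metis norm_triangle_ineq)
    also have "\<dots> \<le> L * t k + R * t k" unfolding R_def
      by (intro add_mono uv green_diff_bound[OF f g M x y xy d])
    finally show ?thesis by (simp add: algebra_simps)
  qed
  then have "r k \<le> L + R" for k unfolding r_def using t_pos[of k] by (simp add: divide_le_eq)
  then have "N \<le> L + R" unfolding N_def by (intro cSUP_least) auto
  also have "R = (D * c * (2 * M) powr q * total) * N + D * total * d * M powr (q + 1)"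
    unfolding R_def by (simp add: algebra_simps)
  also have "(D * c * (2 * M) powr q * total) * N \<le> 1 / 2 * N"
  proof (rule mult_right_mono[OF small])
    have "0 \<le> r 0" unfolding r_def using t_pos[of 0] by simp
    then show "0 \<le> N" using \<open>r 0 \<le> N\<close> by simp
  qed
  finally have "N \<le> 2 * (L + D * total * d * M powr (q + 1))" by (simp add: algebra_simps)
  then show ?thesis using xy[of m] t_pos[of m] by (meson mult_right_mono less_imp_le order_trans)
qed

text \<open>
  Picard iteration in the ball of radius \<open>M\<close>. The inhomogeneity may use up one half of the radius,
  since the integral term maps the ball into one of half the radius.
\<close>
lemma green_solution_exists:
  assumes f: "f \<in> perturbations c q" and M: "0 \<le> M"
    and small: "D * c * (2 * M) powr q * total \<le> 1 / 2"
    and u: "\<And>m. norm (u m) \<le> M / 2 * t m"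
  obtains x where "\<And>k. norm (x k) \<le> M * t k"
    and "\<And>m. x m = u m + (\<Sum>k. G m k (f k (x k)))"
proof -
  define T where "T = (\<lambda>x m. u m + (\<Sum>k. G m k (f k (x k))))"
  define X where "X j = (T ^^ j) (\<lambda>_. 0)" for j
  have XSuc: "X (Suc j) = T (X j)" for j unfolding X_def by simp
  have Tb: "norm (T x m) \<le> M * t m" if x: "\<And>k. norm (x k) \<le> M * t k" for x m
  proof -
    have nf: "norm (f k (x k)) \<le> c * M powr (q + 1) * t k powr (q + 1)" if "1 \<le> k" for k
      by (rule perturbations_norm_weighted[OF f that c_nonneg _ M t_pos x]) (use q_pos in auto)
    have "norm (T x m) \<le> M / 2 * t m + D * total * (c * M powr (q + 1)) * t m"
      unfolding T_def by (intro norm_triangle_mono u green_sum_bound nf)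
    also have "D * total * (c * M powr (q + 1)) \<le> M / 2"
    proof -
      have "D * total * (c * M powr (q + 1)) = D * c * M powr q * total * M"
        using M by (cases "M = 0") (auto simp: powr_add)
      also have "\<dots> \<le> D * c * (2 * M) powr q * total * M"
        using M total_nonneg c_nonneg D_nonneg q_pos
        by (intro mult_right_mono mult_left_mono powr_mono2) auto
      also have "\<dots> \<le> 1 / 2 * M" by (intro mult_right_mono small M)
      finally show ?thesis by simp
    qed
    finally show ?thesis using t_pos[of m] by (simp add: algebra_simps)
  qed
  have Tc: "norm (T x m - T y m) \<le> N / 2 * t m"
    if x: "\<And>k. norm (x k) \<le> M * t k" and y: "\<And>k. norm (y k) \<le> M * t k"
      and xy: "\<And>k. norm (x k - y k) \<le> N * t k" and N: "0 \<le> N" for x y N m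
  proof -
    have "norm (T x m - T y m) \<le> D * total * (c * N * (2 * M) powr q + 0 * M powr (q + 1)) * t m"
      unfolding T_def using green_diff_bound[OF f f M x y xy, of 0 m] by simp
    also have "\<dots> = (D * c * (2 * M) powr q * total) * N * t m" by simp
    also have "\<dots> \<le> 1 / 2 * N * t m"
      using t_pos[of m] N by (intro mult_right_mono small) auto
    finally show ?thesis by simp
  qed
  have Xb: "norm (X j k) \<le> M * t k" for j k
  proof (induction j arbitrary: k)
    case 0
    then show ?case using M t_pos[of k] by (simp add: X_def)
  next
    case (Suc j)
    then show ?case by (simp add: XSuc Tb)
  qed
  \<comment> \<open>Induction on \<open>j\<close>: starting from zero, all iterates lie in the ball, and each step halves the distance.\<close>
  have Xc: "norm (X (j + i) k - X j k) \<le> M * (1 / 2) ^ j * t k" for i j k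
  proof (induction j arbitrary: k)
    case 0
    then show ?case using Xb by (simp add: X_def[of 0])
  next
    case (Suc j)
    show ?case using Tc[OF Xb Xb Suc] M by (simp add: XSuc)
  qed
  have small_tail: "(\<lambda>j. B * (1 / 2) ^ j) \<longlonglongrightarrow> (0::real)" for B
    by (intro tendsto_mult_right_zero LIMSEQ_power_zero) simp
  have "Cauchy (\<lambda>j. X j k)" for k
  proof (rule metric_CauchyI)
    fix e :: real assume "0 < e"
    then have "eventually (\<lambda>j. M * t k * (1 / 2) ^ j < e / 2) sequentially"
      by (intro order_tendstoD(2)[OF small_tail]) simp
    then obtain J where J: "M * t k * (1 / 2) ^ J < e / 2"
      by (meson eventually_sequentially order_refl)
    have near: "dist (X i k) (X J k) < e / 2" if "J \<le> i" for i
      using Xc[of J "i - J" k] J that by (simp add: dist_norm algebra_simps)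
    have "dist (X i k) (X j k) < e" if "J \<le> i" "J \<le> j" for i j
      by (rule dist_triangle_half_l[of _ "X J k"]) (use near[OF that(1)] near[OF that(2)] in auto)
    then show "\<exists>J. \<forall>i\<ge>J. \<forall>j\<ge>J. dist (X i k) (X j k) < e" by blast
  qed
  then have "\<exists>l. (\<lambda>j. X j k) \<longlonglongrightarrow> l" for k
    by (simp add: Cauchy_convergent_iff convergent_def)
  then obtain x where lim: "\<And>k. (\<lambda>j. X j k) \<longlonglongrightarrow> x k" by metis
  have xb: "norm (x k) \<le> M * t k" for k
    by (rule Lim_norm_ubound[OF _ lim]) (use Xb in auto)
  have xX: "norm (x k - X j k) \<le> M * (1 / 2) ^ j * t k" for k j
    by (rule Lim_norm_ubound[OF _ tendsto_diff[OF LIMSEQ_ignore_initial_segment[OF lim, where k = j] tendsto_const]])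
       (use Xc[of j] in \<open>auto simp: add.commute\<close>)
  have "x m = T x m" for m
  proof -
    have "norm (x m - T x m) \<le> M * t m * (1 / 2) ^ j" for j
    proof -
      have "norm (x m - T x m) \<le> norm (x m - X (Suc j) m) + norm (T x m - T (X j) m)"
        by (metis XSuc norm_minus_commute norm_diff_triangle_le order_refl)
      also have "\<dots> \<le> M * (1 / 2) ^ Suc j * t m + M * (1 / 2) ^ j / 2 * t m"
        by (intro add_mono xX Tc[OF xb Xb xX]) (use M in auto)
      finally show ?thesis by simp
    qed
    then have "norm (x m - T x m) \<le> 0"
      by (intro LIMSEQ_le_const[OF small_tail]) blast
    then show ?thesis by simp
  qed
  then show thesis using that[of x] xb unfolding T_def by blast
qed

end

section \<open>Inverses and linear evolutions\<close>

lemma blinfun_inv_eq: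
  assumes "blinfun_invertible T"
  shows "blinfun_inv T o\<^sub>L T = id_blinfun" and "T o\<^sub>L blinfun_inv T = id_blinfun"
proof -
  obtain S where S: "S o\<^sub>L T = id_blinfun" "T o\<^sub>L S = id_blinfun"
    using assms unfolding blinfun_invertible_def by blast
  have "blinfun_inv T = S" unfolding blinfun_inv_def
  proof (rule the_equality)
    show "R = S" if "R o\<^sub>L T = id_blinfun \<and> T o\<^sub>L R = id_blinfun" for R
    proof (rule blinfun_eqI)
      fix x
      have "R x = S (T (R x))" using S(1) by (metis blinfun_apply_blinfun_compose id_blinfun.rep_eq)
      also have "\<dots> = S x" using that by (metis blinfun_apply_blinfun_compose id_blinfun.rep_eq)
      finally show "R x = S x" .
    qed
  qed (use S in simp)
  then show "blinfun_inv T o\<^sub>L T = id_blinfun" "T o\<^sub>L blinfun_inv T = id_blinfun"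
    using S by auto
qed

lemma blinfun_inv_apply:
  assumes "blinfun_invertible T"
  shows "blinfun_inv T (T x) = x" and "T (blinfun_inv T x) = x"
  using blinfun_inv_eq[OF assms] by (metis blinfun_apply_blinfun_compose id_blinfun.rep_eq)+

lemma blinfun_invertible_compose:
  assumes "blinfun_invertible S" and "blinfun_invertible T"
  shows "blinfun_invertible (S o\<^sub>L T)"
  unfolding blinfun_invertible_def
proof (intro exI conjI)
  show "(blinfun_inv T o\<^sub>L blinfun_inv S) o\<^sub>L (S o\<^sub>L T) = id_blinfun"
    by (rule blinfun_eqI) (simp add: blinfun_inv_apply assms)
  show "(S o\<^sub>L T) o\<^sub>L (blinfun_inv T o\<^sub>L blinfun_inv S) = id_blinfun"
    by (rule blinfun_eqI) (simp add: blinfun_inv_apply assms)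
qed

lemma evol_same [simp]: "evol A n n = id_blinfun"
  by (cases n) auto

lemma evol_Suc_apply: "n \<le> m \<Longrightarrow> evol A (Suc m) n x = A m (evol A m n x)"
  by simp

lemma evol_split_apply:
  assumes "n \<le> k" and "k \<le> m"
  shows "evol A m k (evol A k n x) = evol A m n x"
  using assms(2,1) by (induction rule: dec_induct) auto

declare evol.simps(2) [simp del]

section \<open>Dichotomies and their projections\<close>

locale nonuniform_dichotomy =
  fixes A P :: "nat \<Rightarrow> ('a::banach \<Rightarrow>\<^sub>L 'a)"
    and \<mu> \<nu> :: "nat \<Rightarrow> real"
    and c q D a b \<epsilon> :: real
  assumes c_pos: "0 < c" and q_pos: "0 < q"
    and invertible: "\<And>n. 1 \<le> n \<Longrightarrow> blinfun_invertible (A n)"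
    and growth_mu: "growth_rate \<mu>" and growth_nu: "growth_rate \<nu>"
    and dich: "dichotomy A \<mu> \<nu> P D a b \<epsilon>"
    and product_tendsto: "(\<lambda>m. \<mu> m powr a * \<mu> (m - 1) powr (- b) * \<nu> (m - 1) powr \<epsilon>) \<longlonglongrightarrow> 0"
    and series_summable: "summable (\<lambda>k. \<mu> (k + 1) powr (a * q) * \<nu> (k + 1) powr \<epsilon>)"
begin

abbreviation Q :: "nat \<Rightarrow> ('a \<Rightarrow>\<^sub>L 'a)" where
  "Q n \<equiv> compl_proj P n"

abbreviation pullback :: "nat \<Rightarrow> nat \<Rightarrow> ('a \<Rightarrow>\<^sub>L 'a)" where
  "pullback m n \<equiv> blinfun_inv (evol A m n)"

definition decay :: "nat \<Rightarrow> real" where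
  "decay k = \<mu> k powr a"

definition loss :: "nat \<Rightarrow> real" where
  "loss k = \<nu> k powr \<epsilon>"

text \<open>
  The dichotomy reads \<open>norm (evol A m n \<circ> P n) \<le> D * gain n * decay m\<close>: an orbit issuing from a
  stable vector \<open>\<xi>\<close> at time \<open>n\<close> decays like \<open>decay\<close>, with a constant proportional to
  \<open>gain n * norm \<xi>\<close>.
\<close>
definition gain :: "nat \<Rightarrow> real" where
  "gain n = loss (n - 1) / decay (n - 1)"

definition weight :: "nat \<Rightarrow> nat \<Rightarrow> real" where
  "weight n k = (if k < n then 0 else loss k * decay k powr q)"

abbreviation tail :: "nat \<Rightarrow> real" where
  "tail n \<equiv> suminf (weight n)"

lemma constants: "a < 0" "0 \<le> b" "0 \<le> \<epsilon>" "1 \<le> D"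
  using dich unfolding dichotomy_def by auto

lemma mu_ge_1: "1 \<le> \<mu> k"
  using growth_mu unfolding growth_rate_def by (meson incseqD le0 order_trans)

lemma nu_ge_1: "1 \<le> \<nu> k"
  using growth_nu unfolding growth_rate_def by (meson incseqD le0 order_trans)

lemma mu_mono: "i \<le> j \<Longrightarrow> \<mu> i \<le> \<mu> j"
  using growth_mu unfolding growth_rate_def by (meson incseqD)

lemma mu_pos: "0 < \<mu> k"
  using mu_ge_1[of k] by simp

lemma decay_pos: "0 < decay k"
  unfolding decay_def using mu_pos[of k] by simp

lemma loss_ge_1: "1 \<le> loss k"
  unfolding loss_def using nu_ge_1 constants by (simp add: ge_one_powr_ge_zero)

lemma loss_pos: "0 < loss k"
  using loss_ge_1[of k] by simp

lemma gain_pos: "0 < gain n"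
  unfolding gain_def using decay_pos loss_pos by simp

lemma decay_antimono:
  assumes "i \<le> j"
  shows "decay j \<le> decay i"
  unfolding decay_def using mu_mono[OF assms] mu_pos[of i] constants
  by (intro powr_mono2') auto

lemma weight_nonneg: "0 \<le> weight n k"
  unfolding weight_def using loss_pos[of k] by auto

lemma weight_summable: "summable (weight n)"
proof -
  have "summable (\<lambda>k. loss (Suc k) * decay (Suc k) powr q)"
    using series_summable by (simp add: loss_def decay_def powr_powr mult.commute)
  then have s: "summable (\<lambda>k. loss k * decay k powr q)"
    by (simp only: summable_Suc_iff[of "\<lambda>k. loss k * decay k powr q"])
  show ?thesis
    by (rule summable_comparison_test'[OF s]) (use loss_pos in \<open>auto simp: weight_def less_imp_le\<close>)
qed

lemma tail_antimono:
  assumes "n \<le> m"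
  shows "tail m \<le> tail n"
  by (rule suminf_le[OF _ weight_summable weight_summable])
     (use assms loss_pos in \<open>auto simp: weight_def less_imp_le\<close>)

lemma tail_nonneg: "0 \<le> tail n"
  by (rule suminf_nonneg[OF weight_summable weight_nonneg])

lemma tail_pos: "0 < tail n"
  by (rule suminf_pos2[OF weight_summable weight_nonneg, where i = n])
     (use loss_pos[of n] decay_pos[of n] in \<open>simp add: weight_def\<close>)

lemma Q_apply: "Q n x = x - P n x"
  by (simp add: compl_proj_def blinfun.diff_left)

lemma P_idem: "1 \<le> n \<Longrightarrow> P n (P n x) = P n x"
  using dich unfolding dichotomy_def by (metis blinfun_apply_blinfun_compose)

lemma P_evol: "1 \<le> n \<Longrightarrow> n \<le> m \<Longrightarrow> P m (evol A m n x) = evol A m n (P n x)"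
  using dich unfolding dichotomy_def by (metis blinfun_apply_blinfun_compose)

lemma P_step: "1 \<le> n \<Longrightarrow> P (Suc n) (A n x) = A n (P n x)"
  using P_evol[of n "Suc n" x] by (simp add: evol_Suc_apply)

lemma P_Q: "1 \<le> n \<Longrightarrow> P n (Q n x) = 0"
  by (simp add: Q_apply blinfun.diff_right P_idem)

lemma evol_P_bound:
  assumes "1 \<le> n" and "n \<le> m"
  shows "norm (evol A m n o\<^sub>L P n) \<le> D * gain n * decay m"
proof -
  have "norm (evol A m n o\<^sub>L P n) \<le> D * (\<mu> m / \<mu> (n - 1)) powr a * \<nu> (n - 1) powr \<epsilon>"
    using dich assms unfolding dichotomy_def by blast
  also have "\<dots> = D * gain n * decay m"
    using mu_pos[of m] mu_pos[of "n - 1"]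
    by (simp add: gain_def decay_def loss_def powr_divide)
  finally show ?thesis .
qed

lemma pullback_Q_bound:
  assumes "1 \<le> n" and "n \<le> m"
  shows "norm (pullback m n o\<^sub>L Q m) \<le> D * (\<mu> (m - 1) / \<mu> n) powr (- b) * loss (m - 1)"
  using dich assms unfolding dichotomy_def loss_def by blast

lemma evol_invertible:
  assumes "1 \<le> n" and "n \<le> m"
  shows "blinfun_invertible (evol A m n)"
  using assms(2)
proof (induction rule: dec_induct)
  case base
  then show ?case by (auto simp: blinfun_invertible_def intro!: exI[of _ id_blinfun] blinfun_eqI)
next
  case (step m)
  then show ?case using assms(1)
    by (simp add: evol.simps(2) blinfun_invertible_compose invertible)
qed

lemma pullback_evol: "1 \<le> n \<Longrightarrow> n \<le> m \<Longrightarrow> pullback m n (evol A m n x) = x"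
  and evol_pullback: "1 \<le> n \<Longrightarrow> n \<le> m \<Longrightarrow> evol A m n (pullback m n x) = x"
  by (simp_all add: blinfun_inv_apply evol_invertible)

text \<open>
  This and the next two lemmas express the inverse evolution as a cocycle that commutes with the
  projections. They are what makes the Green function below solve the linear difference equation.
\<close>
lemma pullback_Suc:
  assumes "1 \<le> n" and "n \<le> m"
  shows "pullback (Suc m) n (A m x) = pullback m n x"
proof -
  have "A m x = evol A (Suc m) n (pullback m n x)"
    using assms by (simp add: evol_Suc_apply evol_pullback)
  then show ?thesis using assms by (simp add: pullback_evol)
qed

lemma A_pullback:
  assumes "1 \<le> n" and "Suc n \<le> m"
  shows "A n (pullback m n x) = pullback m (Suc n) x"
proof -
  have "evol A m (Suc n) (A n (pullback m n x)) = evol A m n (pullback m n x)"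
    using evol_split_apply[of n "Suc n" m A "pullback m n x"] assms by (simp add: evol_Suc_apply)
  then show ?thesis using assms by (metis pullback_evol evol_pullback Suc_leD le_SucI)
qed

lemma P_pullback:
  assumes "1 \<le> n" and "n \<le> m"
  shows "P n (pullback m n x) = pullback m n (P m x)"
  using assms by (metis P_evol pullback_evol evol_pullback)

section \<open>Decaying orbits and the Lyapunov-Perron equation\<close>

text \<open>
  The Green function of the dichotomy for orbits starting at time \<open>n\<close>: the forcing at time \<open>k\<close> acts
  forwards on the stable part and backwards on the unstable part. It vanishes outside the half line,
  so that sequences on the half line can be treated as sequences on all of \<open>nat\<close>.
\<close>
definition green :: "nat \<Rightarrow> nat \<Rightarrow> nat \<Rightarrow> ('a \<Rightarrow>\<^sub>L 'a)" where
  "green n m k = (if k < n \<or> m < n then 0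
     else if k < m then evol A m (Suc k) o\<^sub>L P (Suc k)
     else - (pullback (Suc k) m o\<^sub>L Q (Suc k)))"

text \<open>
  Both parts of the Green function obey the single bound
  \<open>norm (green n m k) \<le> D * loss k * decay m / decay k\<close>. For the unstable part, where \<open>m \<le> k\<close>, this
  holds because the dichotomy gives \<open>D * loss k\<close> and \<open>decay\<close> is decreasing. Multiplying by
  \<open>decay k powr (q + 1)\<close> gives the summable weight \<open>loss k * decay k powr q\<close>.
\<close>
lemma green_kernel_green:
  assumes n: "1 \<le> n"
  shows "green_kernel (green n) decay (weight n) c q D"
proof
  show "norm (green n m k) * decay k powr (q + 1) \<le> D * decay m * weight n k" for m k
  proof (cases "k < n \<or> m < n")
    case True
    then show ?thesis
      using constants decay_pos[of m] weight_nonneg[of n k] by (auto simp: green_def)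
  next
    case kn: False
    have "norm (green n m k) \<le> D * decay m * loss k / decay k"
    proof (cases "k < m")
      case True
      then show ?thesis
        using kn n evol_P_bound[of "Suc k" m] by (simp add: green_def gain_def algebra_simps)
    next
      case False
      then have km: "m \<le> k" by simp
      have "norm (green n m k) \<le> D * (\<mu> k / \<mu> m) powr (- b) * loss k"
        using False kn n pullback_Q_bound[of m "Suc k"] by (simp add: green_def)
      also have "\<dots> \<le> D * 1 * loss k"
      proof (intro mult_right_mono mult_left_mono)
        have "1 \<le> \<mu> k / \<mu> m" using mu_mono[OF km] mu_pos[of m] by simp
        then have "1 \<le> (\<mu> k / \<mu> m) powr b" using constants by (simp add: ge_one_powr_ge_zero)
        then show "(\<mu> k / \<mu> m) powr (- b) \<le> 1" by (simp add: powr_minus inverse_le_1_iff)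
      qed (use constants loss_pos[of k] in auto)
      also have "\<dots> \<le> D * (decay m / decay k) * loss k"
        using constants loss_pos[of k] decay_antimono[OF km] decay_pos[of k]
        by (intro mult_right_mono mult_left_mono) auto
      finally show ?thesis by (simp add: algebra_simps)
    qed
    then have "norm (green n m k) * decay k powr (q + 1)
        \<le> D * decay m * loss k / decay k * decay k powr (q + 1)"
      by (intro mult_right_mono) auto
    then show ?thesis using kn decay_pos[of k] by (simp add: weight_def powr_add)
  qed
  show "green n m 0 = 0" for m using n by (simp add: green_def)
qed (use c_pos q_pos constants decay_pos weight_nonneg weight_summable in auto)

definition decaying_orbit :: "(nat \<Rightarrow> 'a \<Rightarrow> 'a) \<Rightarrow> nat \<Rightarrow> real \<Rightarrow> (nat \<Rightarrow> 'a) \<Rightarrow> bool" where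
  "decaying_orbit f n M z \<longleftrightarrow>
     (\<forall>k\<ge>n. z (Suc k) = A k (z k) + f k (z k)) \<and> (\<forall>k\<ge>n. norm (z k) \<le> M * decay k)"

lemma stable_variation_of_constants:
  assumes n: "1 \<le> n" and nm: "n \<le> m"
    and z: "\<And>k. n \<le> k \<Longrightarrow> k < m \<Longrightarrow> z (Suc k) = A k (z k) + f k (z k)"
  shows "P m (z m) = evol A m n (P n (z n))
    + (\<Sum>k=n..<m. evol A m (Suc k) (P (Suc k) (f k (z k))))"
  using nm z
proof (induction rule: dec_induct)
  case base
  then show ?case by simp
next
  case (step m)
  have "P (Suc m) (z (Suc m)) = A m (P m (z m)) + P (Suc m) (f m (z m))"
    using step.prems[of m] step.hyps n by (simp add: blinfun.add_right P_step)
  also have "P m (z m) = evol A m n (P n (z n)) + (\<Sum>k=n..<m. evol A m (Suc k) (P (Suc k) (f k (z k))))"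
    using step by simp
  finally show ?case
    using step.hyps by (simp add: blinfun.add_right blinfun.sum_right evol_Suc_apply)
qed

lemma unstable_variation_of_constants:
  assumes m: "1 \<le> m" and mN: "m \<le> N"
    and z: "\<And>k. m \<le> k \<Longrightarrow> z (Suc k) = A k (z k) + f k (z k)"
  shows "pullback N m (Q N (z N)) = Q m (z m)
    + (\<Sum>k=m..<N. pullback (Suc k) m (Q (Suc k) (f k (z k))))"
  using mN
proof (induction rule: dec_induct)
  case base
  show ?case using pullback_evol[OF m, of m "Q m (z m)"] by simp
next
  case (step N)
  have "Q (Suc N) (z (Suc N)) = A N (Q N (z N)) + Q (Suc N) (f N (z N))"
    using z[of N] step.hyps m by (simp add: Q_apply P_step blinfun.add_right blinfun.diff_right)
  then show ?case
    using step m by (simp add: blinfun.add_right pullback_Suc)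
qed

text \<open>
  The boundary term at infinity in the variation of constants formula for the unstable part. It
  disappears because of the limit hypothesis on the product of the rates.
\<close>
lemma pullback_orbit_tendsto_0:
  assumes m: "1 \<le> m" and z: "\<And>k. m \<le> k \<Longrightarrow> norm (z k) \<le> M * decay k"
  shows "(\<lambda>N. pullback N m (Q N (z N))) \<longlonglongrightarrow> 0"
proof (rule Lim_null_comparison)
  show "eventually (\<lambda>N. norm (pullback N m (Q N (z N)))
      \<le> D * \<mu> m powr b * M * (\<mu> N powr a * \<mu> (N - 1) powr (- b) * \<nu> (N - 1) powr \<epsilon>)) sequentially"
    using eventually_ge_at_top[of m]
  proof eventually_elim
    case (elim N)
    have "norm (pullback N m (Q N (z N))) \<le> norm (pullback N m o\<^sub>L Q N) * norm (z N)"
      using norm_blinfun[of "pullback N m o\<^sub>L Q N" "z N"] by simp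
    also have "\<dots> \<le> (D * (\<mu> (N - 1) / \<mu> m) powr (- b) * loss (N - 1)) * (M * decay N)"
      by (rule mult_mono'[OF pullback_Q_bound[OF m elim] z[OF elim]]) auto
    also have "\<dots> = D * \<mu> m powr b * M * (\<mu> N powr a * \<mu> (N - 1) powr (- b) * \<nu> (N - 1) powr \<epsilon>)"
      using mu_pos[of m] mu_pos[of "N - 1"]
      by (simp add: loss_def decay_def powr_divide powr_minus_divide)
    finally show ?case .
  qed
  show "(\<lambda>N. D * \<mu> m powr b * M * (\<mu> N powr a * \<mu> (N - 1) powr (- b) * \<nu> (N - 1) powr \<epsilon>)) \<longlonglongrightarrow> 0"
    by (intro tendsto_mult_right_zero product_tendsto)
qed

text \<open>
  The Lyapunov-Perron equation. The unstable part of a decaying orbit is determined by the whole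
  future: in the backward formula from time \<open>N\<close> to time \<open>m\<close>, let \<open>N\<close> tend to infinity. Only the
  stable component \<open>P n (z n)\<close> of the initial value remains free.
\<close>
lemma decaying_orbit_green_equation:
  assumes n: "1 \<le> n" and nm: "n \<le> m" and z: "decaying_orbit f n M z"
  shows "z m = evol A m n (P n (z n)) + (\<Sum>k. green n m k (f k (z k)))"
proof -
  define F where "F k = green n m k (f k (z k))" for k
  have orb: "\<And>k. n \<le> k \<Longrightarrow> z (Suc k) = A k (z k) + f k (z k)"
    and bd: "\<And>k. n \<le> k \<Longrightarrow> norm (z k) \<le> M * decay k"
    using z unfolding decaying_orbit_def by auto
  have partial: "(\<Sum>k<N. F k) = z m - evol A m n (P n (z n)) - pullback N m (Q N (z N))" if N: "m \<le> N" for N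
  proof -
    have "(\<Sum>k<N. F k) = (\<Sum>k\<in>{n..<m} \<union> {m..<N}. F k)"
      by (rule sum.mono_neutral_right) (use nm N in \<open>auto simp: F_def green_def\<close>)
    also have "\<dots> = (\<Sum>k=n..<m. F k) + (\<Sum>k=m..<N. F k)"
      by (rule sum.union_disjoint) auto
    also have "(\<Sum>k=n..<m. F k) = P m (z m) - evol A m n (P n (z n))"
      using stable_variation_of_constants[OF n nm, of z f] orb nm
      by (simp add: F_def green_def)
    also have "(\<Sum>k=m..<N. F k) = - (\<Sum>k=m..<N. pullback (Suc k) m (Q (Suc k) (f k (z k))))"
      unfolding sum_negf[symmetric]
      by (rule sum.cong) (use nm in \<open>auto simp: F_def green_def blinfun.minus_left\<close>)
    also have "\<dots> = Q m (z m) - pullback N m (Q N (z N))"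
      using unstable_variation_of_constants[of m N z f] orb n nm N by simp
    finally show ?thesis by (simp add: Q_apply)
  qed
  have "(\<lambda>N. z m - evol A m n (P n (z n)) - pullback N m (Q N (z N))) \<longlonglongrightarrow> z m - evol A m n (P n (z n)) - 0"
    by (intro tendsto_intros pullback_orbit_tendsto_0[where M = M]) (use n nm bd in auto)
  then have "(\<lambda>N. z m - evol A m n (P n (z n)) - pullback N m (Q N (z N))) \<longlonglongrightarrow> z m - evol A m n (P n (z n))"
    by simp
  then have "(\<lambda>N. \<Sum>k<N. F k) \<longlonglongrightarrow> z m - evol A m n (P n (z n))"
    by (rule Lim_transform_eventually)
       (use partial in \<open>auto simp: eventually_sequentially intro!: exI[of _ m]\<close>)
  then have "suminf F = z m - evol A m n (P n (z n))"
    by (simp add: sums_def[symmetric] sums_iff)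
  then show ?thesis unfolding F_def by simp
qed

text \<open>
  The Green function is propagated by the linear equation except for a jump at \<open>k = m\<close>, where the
  stable and the unstable part contribute \<open>P (Suc m) v\<close> and \<open>Q (Suc m) v\<close>, which add up to \<open>v\<close>.
\<close>
lemma A_green:
  assumes n: "1 \<le> n" and nm: "n \<le> m"
  shows "A m (green n m k v) = green n (Suc m) k v - (if k = m then v else 0)"
proof -
  consider "k < n" | "n \<le> k" "k < m" | "k = m" | "m < k" by linarith
  then show ?thesis
  proof cases
    case 4
    then show ?thesis using n nm
      by (simp add: green_def blinfun.minus_left blinfun.minus_right A_pullback)
  next
    case 3
    have "A m (pullback (Suc m) m y) = y" for y
      using evol_pullback[of m "Suc m" y] n nm by (simp add: evol_Suc_apply)
    then show ?thesis using 3 n nm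
      by (simp add: green_def blinfun.minus_left blinfun.minus_right Q_apply)
  qed (use n nm in \<open>auto simp: green_def evol_Suc_apply\<close>)
qed

lemma P_green_diag:
  assumes n: "1 \<le> n"
  shows "P n (green n n k v) = 0"
  using n by (simp add: green_def blinfun.minus_left blinfun.minus_right P_pullback P_Q)

text \<open>
  The converse of the Lyapunov-Perron equation: its solutions are orbits, by the jump relation, and
  have the prescribed stable component, since the Green function on the diagonal \<open>m = n\<close> takes values
  in the unstable space.
\<close>
lemma green_equation_decaying_orbit:
  assumes n: "1 \<le> n" and f: "f \<in> perturbations c q" and M: "0 \<le> M"
    and \<xi>: "P n \<xi> = \<xi>" and zb: "\<And>k. norm (z k) \<le> M * decay k"
    and z: "\<And>m. n \<le> m \<Longrightarrow> z m = evol A m n \<xi> + (\<Sum>k. green n m k (f k (z k)))"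
  shows "decaying_orbit f n M z" and "P n (z n) = \<xi>"
proof -
  interpret green_kernel "green n" decay "weight n" c q D by (rule green_kernel_green[OF n])
  have sm: "summable (\<lambda>k. green n m k (f k (z k)))" for m
    by (rule green_summable, rule perturbations_norm_weighted[OF f _ c_nonneg _ M t_pos zb])
       (use q_pos in auto)
  have "z (Suc m) = A m (z m) + f m (z m)" if nm: "n \<le> m" for m
  proof -
    have "A m (\<Sum>k. green n m k (f k (z k))) = (\<Sum>k. A m (green n m k (f k (z k))))"
      by (rule bounded_linear.suminf[OF blinfun.bounded_linear_right sm])
    also have "\<dots> = (\<Sum>k. green n (Suc m) k (f k (z k)) - (if k = m then f k (z k) else 0))"
      by (simp add: A_green[OF n nm])
    also have "\<dots> = (\<Sum>k. green n (Suc m) k (f k (z k))) - (\<Sum>k. if k = m then f k (z k) else 0)"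
      by (rule suminf_diff[symmetric, OF sm]) (rule summable_single)
    also have "(\<Sum>k. if k = m then f k (z k) else 0) = f m (z m)"
      using sums_single[of m "\<lambda>k. f k (z k)"] by (simp add: sums_iff)
    finally show ?thesis
      using z[of m] z[of "Suc m"] nm by (simp add: blinfun.add_right evol_Suc_apply)
  qed
  then show "decaying_orbit f n M z" unfolding decaying_orbit_def using zb by auto
  have "P n (\<Sum>k. green n n k (f k (z k))) = (\<Sum>k. P n (green n n k (f k (z k))))"
    by (rule bounded_linear.suminf[OF blinfun.bounded_linear_right sm])
  then show "P n (z n) = \<xi>"
    using z[of n] by (simp add: P_green_diag[OF n] blinfun.add_right \<xi>)
qed

lemma evol_stable_bound:
  assumes n: "1 \<le> n" and nm: "n \<le> m" and \<xi>: "P n \<xi> = \<xi>"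
  shows "norm (evol A m n \<xi>) \<le> D * gain n * norm \<xi> * decay m"
proof -
  have "norm (evol A m n \<xi>) \<le> norm (evol A m n o\<^sub>L P n) * norm \<xi>"
    using norm_blinfun[of "evol A m n o\<^sub>L P n" \<xi>] \<xi> by simp
  also have "\<dots> \<le> D * gain n * decay m * norm \<xi>"
    by (intro mult_right_mono evol_P_bound n nm) simp
  finally show ?thesis by (simp add: mult_ac)
qed

lemma decaying_orbit_exists:
  assumes n: "1 \<le> n" and f: "f \<in> perturbations c q" and M: "0 \<le> M"
    and small: "D * c * (2 * M) powr q * tail n \<le> 1 / 2"
    and \<xi>: "P n \<xi> = \<xi>" and \<xi>M: "D * gain n * norm \<xi> \<le> M / 2"
  shows "\<exists>z. decaying_orbit f n M z \<and> P n (z n) = \<xi>"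
proof -
  interpret green_kernel "green n" decay "weight n" c q D by (rule green_kernel_green[OF n])
  define u where "u m = (if m < n then 0 else evol A m n \<xi>)" for m
  have u: "norm (u m) \<le> M / 2 * decay m" for m
  proof (cases "m < n")
    case True
    then show ?thesis using M decay_pos[of m] by (simp add: u_def)
  next
    case False
    then have "norm (u m) \<le> D * gain n * norm \<xi> * decay m"
      using evol_stable_bound[OF n _ \<xi>, of m] by (simp add: u_def)
    also have "\<dots> \<le> M / 2 * decay m" by (intro mult_right_mono \<xi>M) (use decay_pos[of m] in simp)
    finally show ?thesis .
  qed
  obtain z where zb: "\<And>k. norm (z k) \<le> M * decay k"
    and z: "\<And>m. z m = u m + (\<Sum>k. green n m k (f k (z k)))"
    by (rule green_solution_exists[OF f M small u]) (rule that)
  have "z m = evol A m n \<xi> + (\<Sum>k. green n m k (f k (z k)))" if "n \<le> m" for m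
    using z[of m] that by (simp add: u_def)
  then show ?thesis
    using green_equation_decaying_orbit[OF n f M \<xi> zb] by blast
qed

text \<open>
  The second estimate is finer than the first one at time \<open>n\<close>: the linear term drops out of the
  unstable components, and what is left has the small factor
  \<open>D * c * (2 * M) powr q * tail n\<close> when both perturbations agree. This gain is needed for a graph with Lipschitz constant \<open>1\<close>.
\<close>
lemma
  assumes n: "1 \<le> n" and f: "f \<in> perturbations c q" and g: "g \<in> perturbations c q"
    and M: "0 \<le> M" and small: "D * c * (2 * M) powr q * tail n \<le> 1 / 2"
    and z: "decaying_orbit f n M z" and w: "decaying_orbit g n M w"
    and d: "0 \<le> d" "\<And>k u. 1 \<le> k \<Longrightarrow> norm (f k u - g k u) \<le> d * norm u powr (q + 1)"
  defines "N \<equiv> 2 * (D * gain n * norm (P n (z n) - P n (w n)) + D * tail n * d * M powr (q + 1))"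
  shows decaying_orbits_close: "n \<le> m \<Longrightarrow> norm (z m - w m) \<le> N * decay m"
    and decaying_orbits_unstable_close: "norm (Q n (z n) - Q n (w n))
      \<le> D * tail n * (c * N * (2 * M) powr q + d * M powr (q + 1)) * decay n"
proof -
  interpret green_kernel "green n" decay "weight n" c q D by (rule green_kernel_green[OF n])
  define z0 w0 where "z0 k = (if k < n then 0 else z k)" and "w0 k = (if k < n then 0 else w k)" for k
  define u v where "u m = (if m < n then 0 else evol A m n (P n (z n)))"
    and "v m = (if m < n then 0 else evol A m n (P n (w n)))" for m
  have zb: "norm (z0 k) \<le> M * decay k" and wb: "norm (w0 k) \<le> M * decay k" for k
    using z w M decay_pos[of k] unfolding decaying_orbit_def z0_def w0_def by auto
  have gz: "(\<Sum>k. green n m k (f k (z0 k))) = (\<Sum>k. green n m k (f k (z k)))"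
    and gw: "(\<Sum>k. green n m k (g k (w0 k))) = (\<Sum>k. green n m k (g k (w k)))" for m
    by (rule suminf_cong, simp add: green_def z0_def w0_def)+
  have zeq: "z0 m = u m + (\<Sum>k. green n m k (f k (z0 k)))" for m
  proof (cases "m < n")
    case False
    then show ?thesis unfolding gz
      using decaying_orbit_green_equation[OF n _ z, of m] by (simp add: z0_def u_def)
  qed (simp add: z0_def u_def green_def)
  have weq: "w0 m = v m + (\<Sum>k. green n m k (g k (w0 k)))" for m
  proof (cases "m < n")
    case False
    then show ?thesis unfolding gw
      using decaying_orbit_green_equation[OF n _ w, of m] by (simp add: w0_def v_def)
  qed (simp add: w0_def v_def green_def)
  have uv: "norm (u m - v m) \<le> D * gain n * norm (P n (z n) - P n (w n)) * decay m" for m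
  proof (cases "m < n")
    case True
    then show ?thesis
      using constants gain_pos[of n] decay_pos[of m] by (simp add: u_def v_def)
  next
    case False
    then show ?thesis
      using evol_stable_bound[OF n, of m "P n (z n) - P n (w n)"] n
      by (simp add: u_def v_def blinfun.diff_right P_idem)
  qed
  have close: "norm (z0 m - w0 m) \<le> N * decay m" for m
    unfolding N_def by (rule green_solutions_close[OF f g M small zb wb zeq weq uv d])
  show "n \<le> m \<Longrightarrow> norm (z m - w m) \<le> N * decay m"
    using close[of m] by (simp add: z0_def w0_def)
  have "Q n (z n) - Q n (w n) = (\<Sum>k. green n n k (f k (z0 k))) - (\<Sum>k. green n n k (g k (w0 k)))"
  proof -
    have "(\<Sum>k. green n n k (f k (z0 k))) = z0 n - u n" "(\<Sum>k. green n n k (g k (w0 k))) = w0 n - v n"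
      using zeq[of n] weq[of n] by (metis add_diff_cancel_left')+
    then show ?thesis by (simp add: Q_apply z0_def w0_def u_def v_def)
  qed
  then show "norm (Q n (z n) - Q n (w n))
      \<le> D * tail n * (c * N * (2 * M) powr q + d * M powr (q + 1)) * decay n"
    using green_diff_bound[OF f g M zb wb close d, of n] by simp
qed

section \<open>Radii of the balls\<close>

abbreviation radius :: "nat \<Rightarrow> real" where
  "radius \<equiv> beta_seq \<mu> \<nu> a \<epsilon> q"

lemma radius_eq: "radius n = decay (n - 1) / (loss (n - 1) * (loss (n - 1) * tail n) powr (1 / q))"
proof -
  have "weight n k = 0" if "k < n" for k using that by (simp add: weight_def)
  from sums_zero_iff_shift[of n "weight n", OF this]
  have "(\<lambda>k. weight n (k + n)) sums tail n"
    using summable_sums[OF weight_summable] by simp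
  then have "(\<Sum>k. \<mu> (k + n) powr (a * q) * \<nu> (k + n) powr \<epsilon>) = tail n"
    by (simp add: sums_iff weight_def loss_def decay_def powr_powr mult.commute)
  moreover have "\<nu> (n - 1) powr (\<epsilon> * (1 + 1 / q)) = loss (n - 1) * loss (n - 1) powr (1 / q)"
    using nu_ge_1[of "n - 1"] by (simp add: loss_def powr_powr distrib_left powr_add)
  ultimately show ?thesis
    using loss_pos[of "n - 1"] tail_pos[of n]
    by (simp add: beta_seq_def decay_def powr_mult mult.assoc)
qed

lemma radius_pos: "0 < radius n"
  using decay_pos[of "n - 1"] loss_pos[of "n - 1"] tail_pos[of n] by (simp add: radius_eq)

text \<open>
  The reason for the choice of the radii. A decaying orbit from the ball of radius \<open>radius n\<close> has a
  constant of order \<open>M = gain n * radius n\<close>, so the contraction constant, a multiple of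
  \<open>M powr q * tail n\<close>, is bounded in \<open>n\<close>. The radii are even so small that a factor
  \<open>1 / loss (n - 1)\<close> is left over; it compensates the nonuniformity that
  \<open>gain n\<close> brings into the unstable component.
\<close>
lemma gain_radius_tail: "(gain n * radius n) powr q * tail n = 1 / loss (n - 1)"
proof -
  have "gain n * radius n = 1 / (loss (n - 1) * tail n) powr (1 / q)"
    using decay_pos[of "n - 1"] loss_pos[of "n - 1"] by (simp add: radius_eq gain_def)
  then have "(gain n * radius n) powr q = 1 / (loss (n - 1) * tail n)"
    using q_pos loss_pos[of "n - 1"] tail_pos[of n] by (simp add: powr_divide powr_powr)
  then show ?thesis using tail_pos[of n] by simp
qed

lemma beta_tilde_eq: "beta_tilde \<mu> \<nu> a \<epsilon> q n = radius n / loss (n - 1)"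
  by (simp add: beta_tilde_def loss_def powr_minus_divide)

lemma stable_ball_iff:
  "1 \<le> n \<Longrightarrow> \<xi> \<in> stable_ball P n r \<longleftrightarrow> P n \<xi> = \<xi> \<and> norm \<xi> < r"
  unfolding stable_ball_def stable_space_def by (auto simp: P_idem) (metis rangeI)

lemma unstable_space_iff: "1 \<le> n \<Longrightarrow> y \<in> unstable_space P n \<longleftrightarrow> P n y = 0"
  unfolding unstable_space_def by (auto simp: P_Q) (metis Q_apply diff_zero rangeI)

end

section \<open>The local stable graph\<close>

text \<open>
  The constant \<open>\<delta>\<close> is small when \<open>D * c * (4 * C * \<delta>) powr q\<close>, a bound for the contraction constant
  on the ball of radius \<open>\<delta> * radius n\<close>, is small. Of the four conditions, the first one gives the
  decaying orbits, the second one keeps the decay constant of their stable components at most \<open>C\<close>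
  (which the nonlinear terms increase from \<open>D\<close>), the third one gives the Lipschitz constant \<open>1\<close> of
  the graphs, and the last one the constant \<open>1\<close> in the dependence on the perturbation.
\<close>
locale local_dichotomy = nonuniform_dichotomy +
  fixes K C \<delta> :: real
  assumes K_ge_1: "1 \<le> K"
    and radius_ratio: "\<And>n m. 1 \<le> n \<Longrightarrow> n \<le> m \<Longrightarrow>
      (\<mu> m powr a * inverse (radius m)) / (\<mu> (n - 1) powr a * inverse (radius n)) \<le> K"
    and D_less_C: "D < C" and delta_pos: "0 < \<delta>"
    and small_half: "D * c * (4 * C * \<delta>) powr q \<le> 1 / 2"
    and small_gap: "2 * C * (D * c * (4 * C * \<delta>) powr q) \<le> C - D"
    and small_lipschitz: "2 * D * (D * c * (4 * C * \<delta>) powr q) \<le> 1"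
    and small_dist: "4 * C * (D * c * (4 * C * \<delta>) powr q) \<le> c"
begin

abbreviation \<kappa> :: real where
  "\<kappa> \<equiv> D * c * (4 * C * \<delta>) powr q"

text \<open>
  The decay constant allowed for an orbit whose stable component at time \<open>n\<close> has norm at most \<open>r\<close>.
  The stable component needs \<open>C * gain n * r\<close>; the factor \<open>2\<close> leaves room for an unstable component
  of the same size, as on a graph with Lipschitz constant \<open>1\<close>.
\<close>
abbreviation cap :: "nat \<Rightarrow> real \<Rightarrow> real" where
  "cap n r \<equiv> 2 * C * gain n * r"

lemma C_pos: "0 < C"
  using D_less_C constants by simp

lemma kappa_nonneg: "0 \<le> \<kappa>"
  using constants c_pos by simp

lemma cap_nonneg: "0 \<le> r \<Longrightarrow> 0 \<le> cap n r"
  using C_pos gain_pos[of n] by simp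

lemma cap_small:
  assumes r: "0 \<le> r" "r \<le> \<delta> * radius n"
  shows "D * c * (2 * cap n r) powr q * tail n \<le> \<kappa> / loss (n - 1)"
    and "D * c * (2 * cap n r) powr q * tail n \<le> 1 / 2"
proof -
  have "2 * cap n r \<le> 4 * C * \<delta> * (gain n * radius n)"
    using mult_left_mono[OF r(2), of "4 * C * gain n"] C_pos gain_pos[of n] by (simp add: mult_ac)
  then have "(2 * cap n r) powr q \<le> (4 * C * \<delta> * (gain n * radius n)) powr q"
    using q_pos cap_nonneg[OF r(1), of n] by (intro powr_mono2) auto
  also have "\<dots> = (4 * C * \<delta>) powr q * (gain n * radius n) powr q"
    using C_pos delta_pos gain_pos[of n] radius_pos[of n] by (intro powr_mult)
  finally have "D * c * (2 * cap n r) powr q * tail n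
      \<le> D * c * ((4 * C * \<delta>) powr q * (gain n * radius n) powr q) * tail n"
    using constants c_pos tail_nonneg[of n] by (intro mult_right_mono mult_left_mono) auto
  also have "\<dots> = \<kappa> * ((gain n * radius n) powr q * tail n)" by simp
  also have "\<dots> = \<kappa> / loss (n - 1)" by (simp add: gain_radius_tail)
  finally show *: "D * c * (2 * cap n r) powr q * tail n \<le> \<kappa> / loss (n - 1)" .
  have "\<kappa> / loss (n - 1) \<le> \<kappa>"
    using kappa_nonneg loss_ge_1[of "n - 1"] by (simp add: divide_le_eq mult_le_cancel_left1)
  then show "D * c * (2 * cap n r) powr q * tail n \<le> 1 / 2"
    using * small_half by simp
qed

lemma cap_powr_bound:
  assumes r: "0 \<le> r" "r \<le> \<delta> * radius n"
  shows "D * tail n * c * cap n r powr (q + 1) \<le> \<kappa> / loss (n - 1) * cap n r"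
proof -
  have "D * tail n * c * cap n r powr (q + 1) = D * c * cap n r powr q * tail n * cap n r"
    using cap_nonneg[OF r(1), of n] by (cases "cap n r = 0") (auto simp: powr_add)
  also have "\<dots> \<le> D * c * (2 * cap n r) powr q * tail n * cap n r"
    using cap_nonneg[OF r(1), of n] constants c_pos tail_nonneg[of n] q_pos
    by (intro mult_right_mono mult_left_mono powr_mono2) auto
  also have "\<dots> \<le> \<kappa> / loss (n - 1) * cap n r"
    by (intro mult_right_mono cap_small r cap_nonneg)
  finally show ?thesis .
qed

text \<open>
  Two different decay constants are allowed, because the orbit through a point at a later time \<open>m\<close> is
  compared with the tail of an orbit that starts at time \<open>n\<close>.
\<close>
lemma decaying_orbit_unique:
  assumes n: "1 \<le> n" and f: "f \<in> perturbations c q"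
    and z: "decaying_orbit f n M z" "0 \<le> M" "D * c * (2 * M) powr q * tail n \<le> 1 / 2"
    and w: "decaying_orbit f n M' w" "0 \<le> M'" "D * c * (2 * M') powr q * tail n \<le> 1 / 2"
    and P: "P n (z n) = P n (w n)" and m: "n \<le> m"
  shows "z m = w m"
proof -
  have "norm (z m - w m) \<le> 2 * (D * gain n * norm (P n (z n) - P n (w n))
      + D * tail n * 0 * (max M M') powr (q + 1)) * decay m"
  proof (rule decaying_orbits_close[OF n f f _ _ _ _ _ _ m])
    show "D * c * (2 * max M M') powr q * tail n \<le> 1 / 2" using z(3) w(3) by (simp add: max_def)
    have "M * decay k \<le> max M M' * decay k" "M' * decay k \<le> max M M' * decay k" for k
      using decay_pos[of k] by auto
    then show "decaying_orbit f n (max M M') z" "decaying_orbit f n (max M M') w"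
      using z(1) w(1) unfolding decaying_orbit_def by (meson order_trans)+
  qed (use z(2) in auto)
  then show ?thesis using P by simp
qed

definition orbit_from :: "(nat \<Rightarrow> 'a \<Rightarrow> 'a) \<Rightarrow> nat \<Rightarrow> 'a \<Rightarrow> nat \<Rightarrow> 'a" where
  "orbit_from f n \<xi> = (SOME z. decaying_orbit f n (cap n (norm \<xi>)) z \<and> P n (z n) = \<xi>)"

text \<open>
  The graph is obtained pointwise, without a fixed point problem for functions: every \<open>\<xi>\<close> in the ball
  of radius \<open>\<delta> * radius n\<close>, and not only in the smaller one of the invariance condition, is the stable
  component of exactly one orbit that decays with the constant \<open>cap n (norm \<xi>)\<close>.
\<close>
definition stable_graph :: "(nat \<Rightarrow> 'a \<Rightarrow> 'a) \<Rightarrow> nat \<Rightarrow> 'a \<Rightarrow> 'a" where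
  "stable_graph f n \<xi> = Q n (orbit_from f n \<xi> n)"

lemma orbit_from:
  assumes n: "1 \<le> n" and f: "f \<in> perturbations c q" and \<xi>: "P n \<xi> = \<xi>" "norm \<xi> \<le> \<delta> * radius n"
  shows "decaying_orbit f n (cap n (norm \<xi>)) (orbit_from f n \<xi>)" and "P n (orbit_from f n \<xi> n) = \<xi>"
proof -
  have "D * gain n * norm \<xi> \<le> C * gain n * norm \<xi>"
    using D_less_C gain_pos[of n] by (intro mult_right_mono) auto
  then have "\<exists>z. decaying_orbit f n (cap n (norm \<xi>)) z \<and> P n (z n) = \<xi>"
    by (intro decaying_orbit_exists n f cap_nonneg cap_small \<xi>) auto
  then have "decaying_orbit f n (cap n (norm \<xi>)) (orbit_from f n \<xi>) \<and> P n (orbit_from f n \<xi> n) = \<xi>"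
    unfolding orbit_from_def by (rule someI_ex)
  then show "decaying_orbit f n (cap n (norm \<xi>)) (orbit_from f n \<xi>)" "P n (orbit_from f n \<xi> n) = \<xi>"
    by auto
qed

text \<open>
  The way in which points are recognized as points of the graph: every orbit that decays with a small
  enough constant starts on it.
\<close>
lemma stable_graph_unique:
  assumes n: "1 \<le> n" and f: "f \<in> perturbations c q" and z: "decaying_orbit f n M z" "0 \<le> M"
    and small: "D * c * (2 * M) powr q * tail n \<le> 1 / 2"
    and le: "norm (P n (z n)) \<le> \<delta> * radius n"
  shows "stable_graph f n (P n (z n)) = Q n (z n)"
proof -
  note o = orbit_from[OF n f P_idem[OF n] le]
  have "orbit_from f n (P n (z n)) n = z n"
    by (rule decaying_orbit_unique[OF n f o(1) cap_nonneg[OF norm_ge_zero]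
        cap_small(2)[OF norm_ge_zero le] z small o(2) order_refl])
  then show ?thesis by (simp add: stable_graph_def)
qed

lemma gain_decay_le: "1 \<le> n \<Longrightarrow> gain n * decay n / loss (n - 1) \<le> 1"
  using decay_antimono[of "n - 1" n] decay_pos[of "n - 1"] loss_pos[of "n - 1"]
  by (simp add: gain_def)

text \<open>
  The factor \<open>gain n\<close> in the distance of the two orbits is cancelled by the factor
  \<open>1 / loss (n - 1)\<close> in the contraction constant, up to \<open>decay n / decay (n - 1) \<le> 1\<close>.
\<close>
lemma stable_graph_lipschitz:
  assumes n: "1 \<le> n" and f: "f \<in> perturbations c q"
    and \<xi>: "\<xi> \<in> stable_ball P n (\<delta> * radius n)" and \<eta>: "\<eta> \<in> stable_ball P n (\<delta> * radius n)"
  shows "norm (stable_graph f n \<xi> - stable_graph f n \<eta>) \<le> norm (\<xi> - \<eta>)"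
proof -
  have \<xi>': "P n \<xi> = \<xi>" "norm \<xi> \<le> \<delta> * radius n" and \<eta>': "P n \<eta> = \<eta>" "norm \<eta> \<le> \<delta> * radius n"
    using \<xi> \<eta> n by (auto simp: stable_ball_iff)
  define M where "M = cap n (max (norm \<xi>) (norm \<eta>))"
  have r: "0 \<le> max (norm \<xi>) (norm \<eta>)" "max (norm \<xi>) (norm \<eta>) \<le> \<delta> * radius n"
    using \<xi>' \<eta>' by (auto simp: le_max_iff_disj)
  have M: "0 \<le> M" unfolding M_def by (rule cap_nonneg[OF r(1)])
  have "cap n (norm \<xi>) \<le> M" "cap n (norm \<eta>) \<le> M"
    unfolding M_def using C_pos gain_pos[of n] by (auto intro!: mult_left_mono)
  then have "cap n (norm \<xi>) * decay k \<le> M * decay k" "cap n (norm \<eta>) * decay k \<le> M * decay k" for k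
    using decay_pos[of k] by auto
  then have z: "decaying_orbit f n M (orbit_from f n \<xi>)" and w: "decaying_orbit f n M (orbit_from f n \<eta>)"
    using orbit_from(1)[OF n f \<xi>'] orbit_from(1)[OF n f \<eta>'] unfolding decaying_orbit_def
    by (meson order_trans)+
  note small = cap_small[OF r, folded M_def]
  define N where "N = 2 * (D * gain n * norm (\<xi> - \<eta>))"
  have N: "0 \<le> N" unfolding N_def using constants gain_pos[of n] by simp
  have "norm (stable_graph f n \<xi> - stable_graph f n \<eta>) \<le> D * tail n * (c * N * (2 * M) powr q) * decay n"
    using decaying_orbits_unstable_close[OF n f f M small(2) z w, of 0]
    by (simp add: stable_graph_def orbit_from(2)[OF n f \<xi>'] orbit_from(2)[OF n f \<eta>'] N_def)
  also have "\<dots> = D * c * (2 * M) powr q * tail n * (N * decay n)" by simp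
  also have "\<dots> \<le> \<kappa> / loss (n - 1) * (N * decay n)"
    using N decay_pos[of n] by (intro mult_right_mono small) auto
  also have "\<dots> = 2 * D * \<kappa> * (gain n * decay n / loss (n - 1)) * norm (\<xi> - \<eta>)"
    by (simp add: N_def)
  also have "\<dots> \<le> 1 * 1 * norm (\<xi> - \<eta>)"
    using gain_pos[of n] decay_pos[of n] loss_pos[of "n - 1"]
    by (intro mult_right_mono mult_mono small_lipschitz gain_decay_le n) auto
  finally show ?thesis by simp
qed

text \<open>
  The defect between the two orbits is \<open>d * D * tail n * M powr (q + 1)\<close> with \<open>M\<close> proportional to
  \<open>gain n * norm \<xi>\<close>; the same cancellation as for the Lipschitz estimate removes \<open>gain n\<close>.
\<close>
lemma stable_graph_perturbation:
  assumes n: "1 \<le> n" and f: "f \<in> perturbations c q" and g: "g \<in> perturbations c q"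
    and \<xi>: "\<xi> \<in> stable_ball P n (\<delta> * radius n)"
    and d: "0 \<le> d" "\<And>k u. 1 \<le> k \<Longrightarrow> norm (f k u - g k u) \<le> d * norm u powr (q + 1)"
  shows "norm (stable_graph f n \<xi> - stable_graph g n \<xi>) \<le> d * norm \<xi>"
proof -
  have \<xi>': "P n \<xi> = \<xi>" "norm \<xi> \<le> \<delta> * radius n"
    using \<xi> n by (auto simp: stable_ball_iff)
  define M where "M = cap n (norm \<xi>)"
  have M: "0 \<le> M" unfolding M_def by (rule cap_nonneg) simp
  note z = orbit_from[OF n f \<xi>', folded M_def] and w = orbit_from[OF n g \<xi>', folded M_def]
  have small: "D * c * (2 * M) powr q * tail n \<le> 1 / 2"
    unfolding M_def using \<xi>' by (intro cap_small) auto
  have "norm (stable_graph f n \<xi> - stable_graph g n \<xi>)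
      = norm (orbit_from f n \<xi> n - orbit_from g n \<xi> n)"
    by (simp add: stable_graph_def Q_apply z(2) w(2))
  also have "\<dots> \<le> 2 * (D * tail n * d * M powr (q + 1)) * decay n"
    using decaying_orbits_close[OF n f g M small z(1) w(1) d order_refl] by (simp add: z(2) w(2))
  also have "\<dots> = 2 * d / c * (D * tail n * c * M powr (q + 1)) * decay n"
    using c_pos by simp
  also have "\<dots> \<le> 2 * d / c * (\<kappa> / loss (n - 1) * M) * decay n"
    unfolding M_def using d(1) c_pos decay_pos[of n] \<xi>'(2)
    by (intro mult_right_mono mult_left_mono cap_powr_bound) auto
  also have "\<dots> = d * (4 * C * \<kappa> / c) * (gain n * decay n / loss (n - 1)) * norm \<xi>"
    by (simp add: M_def)
  also have "\<dots> \<le> d * 1 * 1 * norm \<xi>"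
  proof (intro mult_right_mono mult_mono mult_left_mono gain_decay_le n)
    show "4 * C * \<kappa> / c \<le> 1" using small_dist c_pos by simp
    show "0 \<le> 4 * C * \<kappa> / c"
      by (intro divide_nonneg_pos mult_nonneg_nonneg) (use C_pos c_pos constants in auto)
  qed (use d(1) gain_pos[of n] decay_pos[of n] loss_pos[of "n - 1"] in auto)
  finally show ?thesis by simp
qed

text \<open>
  A bound at time \<open>m\<close> that refers to the orbit only before time \<open>m\<close> and recovers half of the constant
  assumed there. It therefore serves in two ways: it sharpens the bound for a known decaying orbit, and
  it is the induction step that shows decay of an orbit on an invariant graph.
\<close>
lemma stable_part_bound:
  assumes n: "1 \<le> n" and nm: "n \<le> m" and f: "f \<in> perturbations c q"
    and orb: "\<And>k. n \<le> k \<Longrightarrow> k < m \<Longrightarrow> z (Suc k) = A k (z k) + f k (z k)"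
    and r: "norm (P n (z n)) \<le> r" "r \<le> \<delta> * radius n"
    and bd: "\<And>k. n \<le> k \<Longrightarrow> k < m \<Longrightarrow> norm (z k) \<le> cap n r * decay k"
  shows "norm (P m (z m)) \<le> C * gain n * r * decay m"
proof -
  have r0: "0 \<le> r" using r(1) norm_ge_zero order_trans by blast
  have M: "0 \<le> cap n r" by (rule cap_nonneg[OF r0])
  have term_bound: "norm (evol A m (Suc k) (P (Suc k) (f k (z k))))
      \<le> D * c * cap n r powr (q + 1) * decay m * weight n k" if k: "k \<in> {n..<m}" for k
  proof -
    have "norm (evol A m (Suc k) (P (Suc k) (f k (z k))))
        \<le> norm (evol A m (Suc k) o\<^sub>L P (Suc k)) * norm (f k (z k))"
      using norm_blinfun[of "evol A m (Suc k) o\<^sub>L P (Suc k)" "f k (z k)"] by simp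
    also have "\<dots> \<le> (D * gain (Suc k) * decay m) * (c * cap n r powr (q + 1) * decay k powr (q + 1))"
    proof (rule mult_mono')
      show "norm (evol A m (Suc k) o\<^sub>L P (Suc k)) \<le> D * gain (Suc k) * decay m"
        using k by (intro evol_P_bound) auto
      show "norm (f k (z k)) \<le> c * cap n r powr (q + 1) * decay k powr (q + 1)"
        by (rule perturbations_norm_weighted[OF f _ _ _ M decay_pos bd])
           (use k n c_pos q_pos in auto)
    qed auto
    also have "\<dots> = D * c * cap n r powr (q + 1) * decay m * weight n k"
      using k decay_pos[of k] by (simp add: gain_def weight_def powr_add)
    finally show ?thesis .
  qed
  have "norm (\<Sum>k=n..<m. evol A m (Suc k) (P (Suc k) (f k (z k))))
      \<le> (\<Sum>k=n..<m. D * c * cap n r powr (q + 1) * decay m * weight n k)"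
    by (intro sum_norm_le term_bound)
  also have "\<dots> = D * c * cap n r powr (q + 1) * decay m * (\<Sum>k=n..<m. weight n k)"
    by (simp add: sum_distrib_left)
  also have "\<dots> \<le> D * c * cap n r powr (q + 1) * decay m * tail n"
    using constants c_pos decay_pos[of m] weight_nonneg
    by (intro mult_left_mono sum_le_suminf weight_summable) auto
  also have "\<dots> = D * tail n * c * cap n r powr (q + 1) * decay m" by simp
  also have "\<dots> \<le> \<kappa> / loss (n - 1) * cap n r * decay m"
    using decay_pos[of m] by (intro mult_right_mono cap_powr_bound r0 r) auto
  also have "\<dots> \<le> \<kappa> * cap n r * decay m"
    using kappa_nonneg M loss_ge_1[of "n - 1"] decay_pos[of m]
    by (intro mult_right_mono) (auto simp: divide_le_eq mult_le_cancel_left1)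
  also have "\<dots> = (2 * C * \<kappa>) * (gain n * r * decay m)" by simp
  also have "\<dots> \<le> (C - D) * (gain n * r * decay m)"
    using gain_pos[of n] r0 decay_pos[of m] by (intro mult_right_mono small_gap) auto
  finally have sum: "norm (\<Sum>k=n..<m. evol A m (Suc k) (P (Suc k) (f k (z k))))
      \<le> (C - D) * (gain n * r * decay m)" .
  have "norm (evol A m n (P n (z n))) \<le> D * gain n * norm (P n (z n)) * decay m"
    by (rule evol_stable_bound[OF n nm P_idem[OF n]])
  also have "\<dots> \<le> D * gain n * r * decay m"
    using constants gain_pos[of n] decay_pos[of m] by (intro mult_right_mono mult_left_mono r) auto
  finally have "norm (evol A m n (P n (z n))) + norm (\<Sum>k=n..<m. evol A m (Suc k) (P (Suc k) (f k (z k))))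
      \<le> C * gain n * r * decay m"
    using sum by (simp add: algebra_simps)
  moreover have "P m (z m) = evol A m n (P n (z n))
      + (\<Sum>k=n..<m. evol A m (Suc k) (P (Suc k) (f k (z k))))"
    by (rule stable_variation_of_constants[OF n nm]) (rule orb)
  ultimately show ?thesis by (simp add: norm_triangle_le)
qed

text \<open>
  This is where the hypothesis on \<open>K\<close> enters: starting in the ball of radius
  \<open>\<delta> / (C * K) * beta_tilde \<mu> \<nu> a \<epsilon> q n\<close>, the stable component never leaves the larger balls.
\<close>
lemma small_radius:
  assumes n: "1 \<le> n" and nm: "n \<le> m" and r: "r < \<delta> / (C * K) * beta_tilde \<mu> \<nu> a \<epsilon> q n"
  shows "C * gain n * r * decay m < \<delta> * radius m"
proof -
  have "C * gain n * r * decay m < C * gain n * (\<delta> / (C * K) * beta_tilde \<mu> \<nu> a \<epsilon> q n) * decay m"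
    using C_pos gain_pos[of n] decay_pos[of m] r
    by (intro mult_strict_right_mono mult_strict_left_mono) auto
  also have "\<dots> = \<delta> / K * (decay m * radius n / decay (n - 1))"
    using C_pos loss_pos[of "n - 1"] by (simp add: beta_tilde_eq gain_def mult_ac)
  also have "\<dots> \<le> \<delta> / K * (K * radius m)"
  proof (rule mult_left_mono)
    have "(decay m / radius m) / (decay (n - 1) / radius n) \<le> K"
      using radius_ratio[OF n nm] by (simp add: decay_def divide_inverse)
    then show "decay m * radius n / decay (n - 1) \<le> K * radius m"
      using radius_pos[of m] radius_pos[of n] decay_pos[of "n - 1"]
      by (simp add: field_simps)
  qed (use delta_pos K_ge_1 in auto)
  also have "\<dots> = \<delta> * radius m" using K_ge_1 by simp
  finally show ?thesis .
qed

lemma small_radius_le: "\<delta> / (C * K) * beta_tilde \<mu> \<nu> a \<epsilon> q n \<le> \<delta> * radius n"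
proof -
  have "1 * 1 \<le> C * K" using K_ge_1 D_less_C constants by (intro mult_mono) auto
  then have "1 * 1 \<le> C * K * loss (n - 1)" using loss_ge_1[of "n - 1"] by (intro mult_mono) auto
  then have "\<delta> * radius n / (C * K * loss (n - 1)) \<le> \<delta> * radius n / 1"
    using delta_pos radius_pos[of n] by (intro divide_left_mono) auto
  then show ?thesis by (simp add: beta_tilde_eq)
qed

lemma nl_evol_orbit:
  assumes "n \<le> m" and "\<And>k. n \<le> k \<Longrightarrow> z (Suc k) = A k (z k) + f k (z k)"
  shows "nl_evol A f m n (z n) = z m"
  using assms(1)
proof (induction rule: dec_induct)
  case base
  show ?case by (cases n) auto
qed (use assms(2) in simp)

lemma stable_graph_zero:
  assumes n: "1 \<le> n" and f: "f \<in> perturbations c q"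
  shows "stable_graph f n 0 = 0"
proof -
  have "decaying_orbit f n 0 (\<lambda>_. 0)"
    unfolding decaying_orbit_def using perturbations_zero[OF f] n by auto
  then show ?thesis
    using stable_graph_unique[OF n f, of 0 "\<lambda>_. 0"] delta_pos radius_pos[of n] by simp
qed

lemma stable_graph_in_graph_space:
  assumes f: "f \<in> perturbations c q"
  shows "stable_graph f \<in> graph_space P \<delta> radius"
  unfolding graph_space_def mem_Collect_eq
proof (intro allI impI conjI ballI)
  fix n :: nat assume n: "1 \<le> n"
  show lip: "norm (stable_graph f n \<xi> - stable_graph f n \<eta>) \<le> norm (\<xi> - \<eta>)"
    if "\<xi> \<in> stable_ball P n (\<delta> * radius n)" "\<eta> \<in> stable_ball P n (\<delta> * radius n)" for \<xi> \<eta>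
    by (rule stable_graph_lipschitz[OF n f that])
  then have "1-lipschitz_on (stable_ball P n (\<delta> * radius n)) (stable_graph f n)"
    by (intro lipschitz_onI) (auto simp: dist_norm)
  then show "continuous_on (stable_ball P n (\<delta> * radius n)) (stable_graph f n)"
    by (rule lipschitz_on_continuous_on)
  show "stable_graph f n ` stable_ball P n (\<delta> * radius n) \<subseteq> unstable_space P n"
    by (auto simp: stable_graph_def unstable_space_def)
  show "stable_graph f n 0 = 0" by (rule stable_graph_zero[OF n f])
qed

text \<open>
  The tail of a decaying orbit is a decaying orbit, with the constant of time \<open>n\<close> but a smaller
  tail sum; as its stable component stays in the ball, it lies on the graph at every later time.
\<close>
lemma stable_graph_invariant:
  assumes f: "f \<in> perturbations c q"
  shows "invariant_graph A P \<delta> radius (\<delta> / (C * K)) (beta_tilde \<mu> \<nu> a \<epsilon> q) f (stable_graph f)"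
  unfolding invariant_graph_def
proof (intro conjI allI impI subsetI)
  show "stable_graph f \<in> graph_space P \<delta> radius" by (rule stable_graph_in_graph_space[OF f])
  fix n m :: nat and p
  assume n: "1 \<le> n" and nm: "n \<le> m"
    and "p \<in> nl_evol A f m n ` local_graph P (stable_graph f) n (\<delta> / (C * K)) (beta_tilde \<mu> \<nu> a \<epsilon> q)"
  then obtain \<xi> where \<xi>: "P n \<xi> = \<xi>" "norm \<xi> < \<delta> / (C * K) * beta_tilde \<mu> \<nu> a \<epsilon> q n"
    and p: "p = nl_evol A f m n (\<xi> + stable_graph f n \<xi>)"
    by (auto simp: local_graph_def stable_ball_iff[OF n])
  have m: "1 \<le> m" using n nm by simp
  have le: "norm \<xi> \<le> \<delta> * radius n" using \<xi>(2) small_radius_le[of n] by simp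
  define z where "z = orbit_from f n \<xi>"
  define M where "M = cap n (norm \<xi>)"
  have z: "decaying_orbit f n M z" "P n (z n) = \<xi>"
    unfolding z_def M_def using orbit_from[OF n f \<xi>(1) le] by auto
  have orb: "\<And>k. n \<le> k \<Longrightarrow> z (Suc k) = A k (z k) + f k (z k)"
    and bd: "\<And>k. n \<le> k \<Longrightarrow> norm (z k) \<le> M * decay k"
    using z(1) unfolding decaying_orbit_def by auto
  have "\<xi> + stable_graph f n \<xi> = z n"
    using z(2) by (simp add: stable_graph_def z_def Q_apply)
  then have pz: "p = z m" unfolding p using nl_evol_orbit[OF nm, of z f] orb by simp
  have "norm (P m (z m)) \<le> C * gain n * norm \<xi> * decay m"
    by (rule stable_part_bound[OF n nm f orb _ le]) (use z(2) bd in \<open>auto simp: M_def\<close>)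
  also have "\<dots> < \<delta> * radius m" by (rule small_radius[OF n nm \<xi>(2)])
  finally have xm: "norm (P m (z m)) < \<delta> * radius m" .
  have M: "0 \<le> M" "D * c * (2 * M) powr q * tail n \<le> 1 / 2"
    unfolding M_def by (rule cap_nonneg[OF norm_ge_zero], rule cap_small(2)[OF norm_ge_zero le])
  have "D * c * (2 * M) powr q * tail m \<le> D * c * (2 * M) powr q * tail n"
    using constants c_pos by (intro mult_left_mono tail_antimono nm) auto
  then have "stable_graph f m (P m (z m)) = Q m (z m)"
    by (intro stable_graph_unique[OF m f _ M(1)])
       (use M(2) xm z(1) nm in \<open>auto simp: decaying_orbit_def\<close>)
  then have "z m = P m (z m) + stable_graph f m (P m (z m))" by (simp add: Q_apply)
  then show "p \<in> local_graph P (stable_graph f) m \<delta> radius"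
    using xm m by (auto simp: pz local_graph_def stable_ball_iff P_idem)
qed

text \<open>
  An invariant graph in \<open>graph_space\<close> forces its orbits to decay: on it the norm of a point is at most
  twice that of the stable component, and the latter is controlled by induction on time. Decaying
  orbits start on the stable graph.
\<close>
lemma invariant_graph_eq_stable_graph:
  assumes f: "f \<in> perturbations c q"
    and \<psi>: "invariant_graph A P \<delta> radius (\<delta> / (C * K)) (beta_tilde \<mu> \<nu> a \<epsilon> q) f \<psi>"
    and n: "1 \<le> n" and \<xi>: "\<xi> \<in> stable_ball P n (\<delta> / (C * K) * beta_tilde \<mu> \<nu> a \<epsilon> q n)"
  shows "\<psi> n \<xi> = stable_graph f n \<xi>"
proof -
  have \<xi>': "P n \<xi> = \<xi>" "norm \<xi> \<le> \<delta> * radius n"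
    using \<xi> n small_radius_le[of n] by (auto simp: stable_ball_iff)
  define z where "z m = nl_evol A f m n (\<xi> + \<psi> n \<xi>)" for m
  have zn: "z n = \<xi> + \<psi> n \<xi>" unfolding z_def by (cases n) auto
  have orb: "z (Suc k) = A k (z k) + f k (z k)" if "n \<le> k" for k
    unfolding z_def using that by simp
  have graph: "norm (z m) \<le> 2 * norm (P m (z m))" if nm: "n \<le> m" for m
  proof -
    have m: "1 \<le> m" using n nm by simp
    have "z m \<in> local_graph P \<psi> m \<delta> radius"
      using \<psi> n nm \<xi> unfolding invariant_graph_def z_def local_graph_def by blast
    then obtain x where x: "x \<in> stable_ball P m (\<delta> * radius m)" and zx: "z m = x + \<psi> m x"
      unfolding local_graph_def by auto
    have Px: "P m x = x" using x m by (simp add: stable_ball_iff)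
    have \<psi>m: "\<psi> m ` stable_ball P m (\<delta> * radius m) \<subseteq> unstable_space P m" "\<psi> m 0 = 0"
      "\<And>\<xi> \<xi>'. \<xi> \<in> stable_ball P m (\<delta> * radius m) \<Longrightarrow> \<xi>' \<in> stable_ball P m (\<delta> * radius m) \<Longrightarrow>
        norm (\<psi> m \<xi> - \<psi> m \<xi>') \<le> norm (\<xi> - \<xi>')"
      using \<psi> m unfolding invariant_graph_def graph_space_def by auto
    have "P m (\<psi> m x) = 0" using \<psi>m(1) x unstable_space_iff[OF m] by auto
    then have "P m (z m) = x" using Px by (simp add: zx blinfun.add_right)
    moreover have "norm (\<psi> m x) \<le> norm x"
      using \<psi>m(3)[OF x, of 0] \<psi>m(2) m delta_pos radius_pos[of m] by (simp add: stable_ball_iff)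
    ultimately show ?thesis using norm_triangle_ineq[of x "\<psi> m x"] zx by simp
  qed
  have \<psi>\<xi>: "P n (\<psi> n \<xi>) = 0"
  proof -
    have "\<xi> \<in> stable_ball P n (\<delta> * radius n)"
      using \<xi> n small_radius_le[of n] by (auto simp: stable_ball_iff)
    then have "\<psi> n \<xi> \<in> unstable_space P n"
      using \<psi> n unfolding invariant_graph_def graph_space_def by blast
    then show ?thesis using n by (simp add: unstable_space_iff)
  qed
  then have Pz: "P n (z n) = \<xi>" using \<xi>' by (simp add: zn blinfun.add_right)
  have bd: "norm (z m) \<le> cap n (norm \<xi>) * decay m" if "n \<le> m" for m
    using that
  proof (induction m rule: less_induct)
    case (less m)
    have "norm (P m (z m)) \<le> C * gain n * norm \<xi> * decay m"
      by (rule stable_part_bound[OF n less.prems f orb _ \<xi>'(2)]) (use Pz less.IH in auto)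
    then show ?case using graph[OF less.prems] by simp
  qed
  have "decaying_orbit f n (cap n (norm \<xi>)) z"
    unfolding decaying_orbit_def using orb bd by blast
  then have "stable_graph f n (P n (z n)) = Q n (z n)"
    by (rule stable_graph_unique[OF n f _ cap_nonneg[OF norm_ge_zero]
        cap_small(2)[OF norm_ge_zero \<xi>'(2)]]) (use \<xi>' Pz in simp)
  then show ?thesis using Pz by (simp add: Q_apply zn \<psi>\<xi>)
qed

lemma graph_dist_stable_graph_le:
  assumes f: "f \<in> perturbations c q" and g: "g \<in> perturbations c q"
  shows "graph_dist P \<delta> radius (stable_graph f) (stable_graph g) \<le> perturbation_dist q f g"
proof (cases "perturbation_dist q f g = top")
  case False
  define d where "d = enn2real (perturbation_dist q f g)"
  have d0: "0 \<le> d" and de: "ennreal d = perturbation_dist q f g"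
    unfolding d_def using False by (auto simp: less_top)
  have d: "norm (f k u - g k u) \<le> d * norm u powr (q + 1)" if k: "1 \<le> k" for k u
  proof (cases "u = 0")
    case True
    then show ?thesis using perturbations_zero[OF f k] perturbations_zero[OF g k] by simp
  next
    case u: False
    have "ennreal (norm (f k u - g k u) / norm u powr (q + 1)) \<le> ennreal d"
      unfolding de perturbation_dist_def by (rule Sup_upper) (use k u in blast)
    then have "norm (f k u - g k u) / norm u powr (q + 1) \<le> d" using d0 by simp
    then show ?thesis using u by (simp add: divide_le_eq)
  qed
  show ?thesis
    unfolding graph_dist_def de[symmetric]
  proof (rule Sup_least)
    fix x assume "x \<in> {ennreal (norm (stable_graph f n \<xi> - stable_graph g n \<xi>) / norm \<xi>) | n \<xi>.
      1 \<le> n \<and> \<xi> \<in> stable_ball P n (\<delta> * radius n) - {0}}"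
    then obtain n \<xi> where n: "1 \<le> n" and \<xi>: "\<xi> \<in> stable_ball P n (\<delta> * radius n)" "\<xi> \<noteq> 0"
      and x: "x = ennreal (norm (stable_graph f n \<xi> - stable_graph g n \<xi>) / norm \<xi>)"
      by blast
    show "x \<le> ennreal d"
      unfolding x using stable_graph_perturbation[OF n f g \<xi>(1) d0 d] \<xi>(2)
      by (intro ennreal_leI) (simp add: divide_le_eq)
  qed
qed simp

end

section \<open>From the stable graph to unique invariant graphs\<close>

text \<open>
  With this, a graph that is unique on the balls of radius \<open>\<delta> * \<beta> n\<close> can be replaced by the stable
  graph constructed above.
\<close>
lemma graph_dist_cong:
  assumes "same_on_balls P (\<lambda>n. \<delta> * \<beta> n) \<phi>' \<phi>" and "same_on_balls P (\<lambda>n. \<delta> * \<beta> n) \<psi>' \<psi>"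
  shows "graph_dist P \<delta> \<beta> \<phi>' \<psi>' = graph_dist P \<delta> \<beta> \<phi> \<psi>"
proof -
  have "{ennreal (norm (\<phi>' n \<xi> - \<psi>' n \<xi>) / norm \<xi>) | n \<xi>.
        1 \<le> n \<and> \<xi> \<in> stable_ball P n (\<delta> * \<beta> n) - {0}}
      = {ennreal (norm (\<phi> n \<xi> - \<psi> n \<xi>) / norm \<xi>) | n \<xi>.
        1 \<le> n \<and> \<xi> \<in> stable_ball P n (\<delta> * \<beta> n) - {0}}"
    using assms unfolding same_on_balls_def by (intro Collect_cong iff_exI) auto
  then show ?thesis unfolding graph_dist_def by simp
qed

lemma small_powr_scale:
  fixes c D B q :: real
  assumes "0 < c" "0 < D" "0 < B" "0 < q" "0 < e"
  obtains \<delta>\<^sub>0 where "0 < \<delta>\<^sub>0" and "\<And>\<delta>. 0 < \<delta> \<Longrightarrow> \<delta> < \<delta>\<^sub>0 \<Longrightarrow> D * c * (B * \<delta>) powr q \<le> e"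
proof
  define s where "s = (e / (D * c)) powr (1 / q)"
  show "0 < s / B" unfolding s_def using assms by simp
  fix \<delta> assume \<delta>: "0 < \<delta>" "\<delta> < s / B"
  then have "B * \<delta> \<le> s" using assms by (simp add: less_divide_eq mult.commute)
  then have "(B * \<delta>) powr q \<le> s powr q" using assms \<delta> by (intro powr_mono2) auto
  also have "\<dots> = e / (D * c)" unfolding s_def using assms by (simp add: powr_powr)
  finally show "D * c * (B * \<delta>) powr q \<le> e" using assms by (simp add: field_simps)
qed

theorem theorem2:
  fixes A P :: "nat \<Rightarrow> ('a::banach \<Rightarrow>\<^sub>L 'a)"
    and \<mu> \<nu> \<beta> \<beta>' :: "nat \<Rightarrow> real"
    and c q D a b \<epsilon> K C :: real
  defines "\<beta> \<equiv> beta_seq \<mu> \<nu> a \<epsilon> q"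
    and "\<beta>' \<equiv> beta_tilde \<mu> \<nu> a \<epsilon> q"
  assumes "c > 0" and "q > 1"
    and "\<And>n. n \<ge> 1 \<Longrightarrow> blinfun_invertible (A n)"
    and "growth_rate \<mu>" and "growth_rate \<nu>"
    and "dichotomy A \<mu> \<nu> P D a b \<epsilon>"
    and "\<epsilon> > 0"
    and "(\<lambda>m. \<mu> m powr a * \<mu> (m - 1) powr (- b) * \<nu> (m - 1) powr \<epsilon>) \<longlonglongrightarrow> 0"
    and "summable (\<lambda>k. \<mu> (k + 1) powr (a * q) * \<nu> (k + 1) powr \<epsilon>)"
    and "K \<ge> 1"
    and "\<And>n m. n \<ge> 1 \<Longrightarrow> m \<ge> n \<Longrightarrow>
           (\<mu> m powr a * inverse (\<beta> m)) / (\<mu> (n - 1) powr a * inverse (\<beta> n)) \<le> K"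
    and "C > D"
  shows "\<exists>\<delta>\<^sub>0>0. \<forall>\<delta>. 0 < \<delta> \<and> \<delta> < \<delta>\<^sub>0 \<longrightarrow>
    (\<forall>f\<in>perturbations c q. \<forall>g\<in>perturbations c q. \<forall>\<phi> \<psi>.
        unique_invariant_graph A P \<delta> \<beta> (\<delta> / (C * K)) \<beta>' f \<phi> \<longrightarrow>
        unique_invariant_graph A P \<delta> \<beta> (\<delta> / (C * K)) \<beta>' g \<psi> \<longrightarrow>
        graph_dist P \<delta> \<beta> \<phi> \<psi> \<le> perturbation_dist q f g) \<and>
    (\<exists>\<Phi>.
        (\<forall>f\<in>perturbations c q.
            invariant_graph A P \<delta> \<beta> (\<delta> / (C * K)) \<beta>' f (\<Phi> f) \<and>
            (\<forall>\<psi>. invariant_graph A P \<delta> \<beta> (\<delta> / (C * K)) \<beta>' f \<psi> \<longrightarrow>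
                 same_on_balls P (\<lambda>n. \<delta> / (C * K) * \<beta>' n) \<psi> (\<Phi> f))) \<and>
        (\<forall>f\<in>perturbations c q. \<forall>g\<in>perturbations c q.
            graph_dist P \<delta> \<beta> (\<Phi> f) (\<Phi> g) \<le> perturbation_dist q f g))"
proof -
  interpret nonuniform_dichotomy A P \<mu> \<nu> c q D a b \<epsilon>
    using assms(3-11) by unfold_locales auto
  have C: "0 < C" using \<open>C > D\<close> constants by simp
  \<comment> \<open>The four entries of the minimum correspond to the four smallness conditions of \<open>local_dichotomy\<close>.\<close>
  define e where "e = min (min (1 / 2) ((C - D) / (2 * C))) (min (1 / (2 * D)) (c / (4 * C)))"
  have e: "0 < e" unfolding e_def using C \<open>C > D\<close> constants \<open>c > 0\<close> by auto
  obtain \<delta>\<^sub>0 where \<delta>\<^sub>0: "0 < \<delta>\<^sub>0"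
    and small: "\<And>\<delta>. 0 < \<delta> \<Longrightarrow> \<delta> < \<delta>\<^sub>0 \<Longrightarrow> D * c * (4 * C * \<delta>) powr q \<le> e"
    by (rule small_powr_scale[of c D "4 * C" q e]) (use C constants \<open>c > 0\<close> q_pos e in auto)
  show ?thesis
  proof (intro exI[of _ \<delta>\<^sub>0] conjI \<delta>\<^sub>0 allI impI)
    fix \<delta> assume \<delta>: "0 < \<delta> \<and> \<delta> < \<delta>\<^sub>0"
    define \<kappa>' where "\<kappa>' = D * c * (4 * C * \<delta>) powr q"
    have "\<kappa>' \<le> 1 / 2" "\<kappa>' \<le> (C - D) / (2 * C)" "\<kappa>' \<le> 1 / (2 * D)" "\<kappa>' \<le> c / (4 * C)"
      using small[of \<delta>] \<delta> unfolding \<kappa>'_def e_def by auto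
    then have \<kappa>': "\<kappa>' \<le> 1 / 2" "2 * C * \<kappa>' \<le> C - D" "2 * D * \<kappa>' \<le> 1" "4 * C * \<kappa>' \<le> c"
      using C constants by (auto simp: le_divide_eq mult_ac)
    interpret local_dichotomy A P \<mu> \<nu> c q D a b \<epsilon> K C \<delta>
      using assms(12-14) \<delta> \<kappa>' unfolding \<kappa>'_def \<beta>_def by unfold_locales auto
    note inv = stable_graph_invariant[folded \<beta>_def \<beta>'_def]
      and dist = graph_dist_stable_graph_le[folded \<beta>_def]
    show "\<exists>\<Phi>.
        (\<forall>f\<in>perturbations c q.
            invariant_graph A P \<delta> \<beta> (\<delta> / (C * K)) \<beta>' f (\<Phi> f) \<and>
            (\<forall>\<psi>. invariant_graph A P \<delta> \<beta> (\<delta> / (C * K)) \<beta>' f \<psi> \<longrightarrow>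
                 same_on_balls P (\<lambda>n. \<delta> / (C * K) * \<beta>' n) \<psi> (\<Phi> f))) \<and>
        (\<forall>f\<in>perturbations c q. \<forall>g\<in>perturbations c q.
            graph_dist P \<delta> \<beta> (\<Phi> f) (\<Phi> g) \<le> perturbation_dist q f g)"
      using inv dist invariant_graph_eq_stable_graph[folded \<beta>_def \<beta>'_def]
      by (intro exI[of _ stable_graph]) (auto simp: same_on_balls_def)
    show "\<forall>f\<in>perturbations c q. \<forall>g\<in>perturbations c q. \<forall>\<phi> \<psi>.
        unique_invariant_graph A P \<delta> \<beta> (\<delta> / (C * K)) \<beta>' f \<phi> \<longrightarrow>
        unique_invariant_graph A P \<delta> \<beta> (\<delta> / (C * K)) \<beta>' g \<psi> \<longrightarrow>
        graph_dist P \<delta> \<beta> \<phi> \<psi> \<le> perturbation_dist q f g"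
    proof (intro ballI allI impI)
      fix f g \<phi> \<psi>
      assume f: "f \<in> perturbations c q" and g: "g \<in> perturbations c q"
        and "unique_invariant_graph A P \<delta> \<beta> (\<delta> / (C * K)) \<beta>' f \<phi>"
        and "unique_invariant_graph A P \<delta> \<beta> (\<delta> / (C * K)) \<beta>' g \<psi>"
      then have "same_on_balls P (\<lambda>n. \<delta> * \<beta> n) (stable_graph f) \<phi>"
        and "same_on_balls P (\<lambda>n. \<delta> * \<beta> n) (stable_graph g) \<psi>"
        using inv unfolding unique_invariant_graph_def by blast+
      then have "graph_dist P \<delta> \<beta> (stable_graph f) (stable_graph g) = graph_dist P \<delta> \<beta> \<phi> \<psi>"
        by (rule graph_dist_cong)
      then show "graph_dist P \<delta> \<beta> \<phi> \<psi> \<le> perturbation_dist q f g"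
        using dist[OF f g] by simp
    qed
  qed
qed

end
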